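(* Consider the game $\mathbf{0.33}$ and the set $\mathcal{R}$ consisting of the empty graph and all subdivided stars whose paths all have $1$ or $2$ vertices. Define subsets of $\mathcal R$: $\mathcal D_0^*$ = elements $S$ with $\mathcal{G}(S)=0$ having zero or exactly two paths with $2$ vertices, together with $S_2$; $\mathcal D_1^*=\{P_1,S_{2,1},S_{2,2,2}\}$; $\mathcal D_1^{\Box}$ = stars $S\ne P_1$ with $\mathcal{G}(S)=1$ having zero or exactly two paths with $2$ vertices; $\mathcal D_2^*=\{S_1,S_{2,2}\}$; $\mathcal D_2^{\Box}$ = stars with $\mathcal{G}(S)=2$ having exactly one or exactly three paths with $2$ vertices; $\mathcal D_3^{\Box}$ = stars with $\mathcal{G}(S)=3$ having exactly one or exactly three paths with $2$ vertices; and for $i\in\{0,1,2,3\}$, $\mathcal D_i$ = elements $S$ with $\mathcal{G}(S)=i$ not in any previous class. Then the equivalence classes of $\mathcal R$ under $\sim_2$ are exactly $\mathcal D_0,\mathcal D_0^*,\mathcal D_1,\mathcal D_1^*,\mathcal D_1^{\Box},\mathcal D_2,\mathcal D_2^*,\mathcal D_2^{\Box},\mathcal D_3,\mathcal D_3^{\Box}$, and for $S$ in the class of the row and $S'$ in the class of the column, $\mathcal{G}(S\overset{2}{-}S')$ is given by the table below, where $\oplus$ means $\mathcal{G}(S)\oplus\mathcal{G}(S')$ and $\oplus_1$ means $\mathcal{G}(S)\oplus\mathcal{G}(S')\oplus 1$: \[\begin{array}{c|cccccccccc} &\mathcal D_0 & \mathcal D_0^* & \mathcal D_1 & \mathcal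 D_1^* & \mathcal D_1^{\Box} & \mathcal D_2 & \mathcal D_2^* & \mathcal D_2^{\Box} & \mathcal D_3 & \mathcal D_3^{\Box} \\ \hline \mathcal D_0 & \oplus & \oplus_1 & \oplus & 2 & \oplus_1 & \oplus & 0 & \oplus_1 & \oplus & \oplus_1 \\ \mathcal D_0^* & \oplus_1 & \oplus_1 & \oplus_1 & 2 & \oplus_1 & \oplus_1 & 0 & \oplus_1 & \oplus_1 & \oplus_1 \\ \mathcal D_1 & \oplus & \oplus_1 & \oplus & 3 & \oplus_1 & \oplus & 1 & \oplus_1 & \oplus & \oplus_1 \\ \mathcal D_1^* & 2 & 2 & 3 & 0 & 3 & 0 & 1 & 1 & 1 & 0 \\ \mathcal D_1^{\Box} & \oplus_1 & \oplus_1 & \oplus_1 & 3 & \oplus_1 & \oplus_1 & 1 & \oplus_1 & \oplus_1 & \oplus_1 \\ \mathcal D_2 & \oplus & \oplus_1 & \oplus & 0 & \oplus_1 & \oplus & 2 & \oplus_1 & \oplus & \oplus_1 \\ \mathcal D_2^* & 0 & 0 & 1 & 1 & 1 & 2 & 2 & 2 & 3 & 3 \\ \mathcal D_2^{\Box} & \oplus_1 & \oplus_1 & \oplus_1 & 1 & \oplus_1 & \oplus_1 & 2 & 0 & \oplus_1 & 1 \\ \mathcal D_3 & \oplus & \oplus_1 & \oplus & 1 & \oplus_1 & \oplus & 3 & \oplus_1 & \oplus & \oplus_1 \\ \mathcal D_3^{\Box} & \oplus_1 & \oplus_1 & \oplus_1 & 0 & \oplus_1 & \oplus_1 & 3 &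 1 & \oplus_1 & 0 \end{array}\]
   Context: The game $\mathbf{0.33}$ on a finite graph $G$: players alternate; a move chooses a set $X$ of one vertex or of two adjacent vertices of $G$, lying in a connected component $H$ of $G$, such that $H-X$ is empty or connected, and deletes $X$. A player unable to move loses (normal play). Grundy value: $\mathcal{G}(G)=\mathrm{mex}\{\mathcal{G}(G'): G' \text{ reachable in one move}\}$; $\oplus$ is bitwise XOR. Subdivided star $S_{\ell_1,\ldots,\ell_k}$ ($k\ge0$, $\ell_i\ge1$): a central vertex $c$ with $k$ vertex-disjoint paths of $\ell_1,\ldots,\ell_k$ vertices each having one endpoint adjacent to $c$ ($P_1$ if $k=0$; $S_1=P_2$, $S_2=P_3$). Bistar: for subdivided stars $S,S'$ with centers $c,c'$, $S\overset{2}{-}S'$ is the disjoint union of $S$ and $S'$ plus a new vertex $v$ adjacent to both $c$ and $c'$; if $S'$ is empty, $S\overset{2}{-}\emptyset$ is $S$ plus a new vertex adjacent to $c$ (symmetrically for $S$ empty), and $\emptyset\overset{2}{-}\emptyset=P_1$. $G_1\equiv G_2$ iff $\mathcal{G}(G_1)=\mathcal{G}(G_2)$. $S\sim_2 S'$ iff $S\overset{2}{-}\hat S\equiv S'\overset{2}{-}\hat S$ for every subdivided star (or empty graph) $\hat S$. *)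

theory Defs
  imports "Graph_Theory.Graph_Theory" "HOL-Library.Multiset"
begin

text \<open>
  Undirected graphs are symmetric digraphs. Components are the maximal connected subgraphs;
  a \<^const>\<open>connected\<close> graph is nonempty by definition.
\<close>

definition move033 :: "('a, 'b) pre_digraph \<Rightarrow> ('a, 'b) pre_digraph \<Rightarrow> bool" where
  "move033 G G' \<longleftrightarrow>
    (\<exists>H X. pre_digraph.max_subgraph G connected H \<and> X \<subseteq> verts H \<and>
       ((\<exists>v. X = {v}) \<or> (\<exists>u v. X = {u, v} \<and> u \<rightarrow>\<^bsub>G\<^esub> v)) \<and>
       (verts H - X = {} \<or> connected (H \<restriction> (verts H - X))) \<and>
       G' = G \<restriction> (verts G - X))"

definition mex :: "nat set \<Rightarrow> nat" where
  "mex A = (LEAST n. n \<notin> A)"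

lemma move033_card_less:
  assumes "finite (verts G)" and "move033 G G'"
  shows "card (verts G') < card (verts G)"
proof -
  obtain H X where H: "pre_digraph.max_subgraph G connected H" "X \<subseteq> verts H"
    "X \<noteq> {}" "G' = G \<restriction> (verts G - X)"
    using assms(2) by (auto simp: move033_def)
  then have "X \<subseteq> verts G"
    by (auto simp: pre_digraph.max_subgraph_def subgraph_def)
  with H assms(1) show ?thesis
    by (auto intro!: psubset_card_mono)
qed

text \<open>The value on infinite graphs is irrelevant and set to 0.\<close>

function grundy :: "('a, 'b) pre_digraph \<Rightarrow> nat" where
  "grundy G = (if finite (verts G) then mex (grundy ` {G'. move033 G G'}) else 0)"
  by auto
termination
  by (relation "measure (\<lambda>G. card (verts G))") (auto intro: move033_card_less)

declare grundy.simps [simp del]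

text \<open>
  A subdivided star is given, up to isomorphism fixing the center, by the multiset of the
  numbers of vertices of its paths: \<open>Star {#}\<close> is $P_1$, \<open>Star {#2, 1#}\<close> is $S_{2,1}$.
\<close>

datatype star = Empty | Star "nat multiset"

definition stars_or_empty :: "star set" where
  "stars_or_empty = insert Empty {Star M | M. \<forall>l \<in># M. l \<ge> 1}"

text \<open>
  \<open>On_Path l i j\<close> is the \<open>j\<close>-th vertex, counted from the center starting with 1, of the \<open>i\<close>-th
  among the paths with \<open>l\<close> vertices.
\<close>

datatype star_vertex = Center | On_Path nat nat nat

fun star_edges :: "star \<Rightarrow> star_vertex rel" where
  "star_edges Empty = {}"
| "star_edges (Star M) =
     {(Center, On_Path l i 1) | l i. i < count M l \<and> 1 \<le> l} \<union>
     {(On_Path l i j, On_Path l i (j + 1)) | l i j. i < count M l \<and> 1 \<le> j \<and> j + 1 \<le> l}"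

fun star_verts :: "star \<Rightarrow> star_vertex set" where
  "star_verts Empty = {}"
| "star_verts (Star M) =
     insert Center {On_Path l i j | l i j. i < count M l \<and> 1 \<le> j \<and> j \<le> l}"

definition star_graph :: "star \<Rightarrow> star_vertex pair_pre_digraph" where
  "star_graph S = \<lparr> pverts = star_verts S, parcs = star_edges S \<union> (star_edges S)\<inverse> \<rparr>"

datatype bistar_vertex = Middle | In_Left star_vertex | In_Right star_vertex

definition bistar_edges :: "star \<Rightarrow> star \<Rightarrow> bistar_vertex rel" where
  "bistar_edges S T =
     map_prod In_Left In_Left ` star_edges S \<union> map_prod In_Right In_Right ` star_edges T \<union>
     (if S = Empty then {} else {(Middle, In_Left Center)}) \<union>
     (if T = Empty then {} else {(Middle, In_Right Center)})"

definition bistar :: "star \<Rightarrow> star \<Rightarrow> bistar_vertex pair_pre_digraph" where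
  "bistar S T =
     \<lparr> pverts = insert Middle (In_Left ` star_verts S \<union> In_Right ` star_verts T),
       parcs = bistar_edges S T \<union> (bistar_edges S T)\<inverse> \<rparr>"

lemma finite_star_verts: "finite (star_verts S)"
proof (cases S)
  case (Star M)
  have "{On_Path l i j | l i j. i < count M l \<and> 1 \<le> j \<and> j \<le> l} \<subseteq>
        (\<Union>l \<in> set_mset M. \<Union>i \<in> {..<count M l}. On_Path l i ` {..l})"
  proof
    fix x assume "x \<in> {On_Path l i j | l i j. i < count M l \<and> 1 \<le> j \<and> j \<le> l}"
    then obtain l i j where x: "x = On_Path l i j" "i < count M l" "j \<le> l"
      by blast
    moreover have "l \<in># M"
      using x(2) by (auto simp flip: count_greater_zero_iff)
    ultimately show "x \<in> (\<Union>l \<in> set_mset M. \<Union>i \<in> {..<count M l}. On_Path l i ` {..l})"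
      by blast
  qed
  from finite_subset[OF this] show ?thesis
    using Star by simp
qed simp

lemma star_edges_wf: "(u, v) \<in> star_edges S \<Longrightarrow> u \<in> star_verts S \<and> v \<in> star_verts S \<and> u \<noteq> v"
  by (cases S) auto

lemma pair_graphI_sym:
  assumes "finite V" and "\<And>u v. (u, v) \<in> E \<Longrightarrow> u \<in> V \<and> v \<in> V \<and> u \<noteq> v"
  shows "pair_graph \<lparr> pverts = V, parcs = E \<union> E\<inverse> \<rparr>"
proof -
  have "E \<union> E\<inverse> \<subseteq> V \<times> V"
    using assms(2) by auto
  then have "finite (E \<union> E\<inverse>)"
    using assms(1) finite_subset by blast
  then show ?thesis
    using assms by unfold_locales (force simp: symmetric_def sym_def)+
qed

lemma pair_graph_star_graph: "pair_graph (star_graph S)"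
  unfolding star_graph_def
  by (rule pair_graphI_sym) (auto simp: finite_star_verts dest: star_edges_wf)

lemma pair_graph_bistar: "pair_graph (bistar S T)"
proof -
  have "Center \<in> star_verts U" if "U \<noteq> Empty" for U
    using that by (cases U) auto
  then show ?thesis
    unfolding bistar_def
    by (intro pair_graphI_sym)
       (auto simp: finite_star_verts bistar_edges_def split: if_splits dest: star_edges_wf)
qed

definition sim2 :: "star \<Rightarrow> star \<Rightarrow> bool" (infix \<open>\<sim>\<^sub>2\<close> 50) where
  "S \<sim>\<^sub>2 S' \<longleftrightarrow> (\<forall>T \<in> stars_or_empty. grundy (bistar S T) = grundy (bistar S' T))"

abbreviation star_grundy :: "star \<Rightarrow> nat" (\<open>\<G>\<close>) where
  "\<G> S \<equiv> grundy (star_graph S)"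

fun paths2 :: "star \<Rightarrow> nat" where
  "paths2 Empty = 0"
| "paths2 (Star M) = count M 2"

definition \<R> :: "star set" where
  "\<R> = insert Empty {Star M | M. set_mset M \<subseteq> {1, 2}}"

definition D0_star :: "star set" where
  "D0_star = insert (Star {#2#}) {S \<in> \<R>. \<G> S = 0 \<and> paths2 S \<in> {0, 2}}"

definition D1_star :: "star set" where
  "D1_star = {Star {#}, Star {#2, 1#}, Star {#2, 2, 2#}}"

definition D1_box :: "star set" where
  "D1_box = {S \<in> \<R>. S \<noteq> Star {#} \<and> \<G> S = 1 \<and> paths2 S \<in> {0, 2}}"

definition D2_star :: "star set" where
  "D2_star = {Star {#1#}, Star {#2, 2#}}"

definition D2_box :: "star set" where
  "D2_box = {S \<in> \<R>. \<G> S = 2 \<and> paths2 S \<in> {1, 3}}"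

definition D3_box :: "star set" where
  "D3_box = {S \<in> \<R>. \<G> S = 3 \<and> paths2 S \<in> {1, 3}}"

definition D_plain :: "nat \<Rightarrow> star set" where
  "D_plain i = {S \<in> \<R>. \<G> S = i} -
     (D0_star \<union> D1_star \<union> D1_box \<union> D2_star \<union> D2_box \<union> D3_box)"

definition classes :: "star set list" where
  "classes = [D_plain 0, D0_star, D_plain 1, D1_star, D1_box,
              D_plain 2, D2_star, D2_box, D_plain 3, D3_box]"

datatype entry = Xor | Xor1 | Val nat

fun entry_value :: "entry \<Rightarrow> nat \<Rightarrow> nat \<Rightarrow> nat" where
  "entry_value Xor a b = Bit_Operations.xor a b"
| "entry_value Xor1 a b = Bit_Operations.xor (Bit_Operations.xor a b) 1"
| "entry_value (Val n) a b = n"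

text \<open>Rows and columns are in the order of \<^const>\<open>classes\<close>.\<close>

definition grundy_table :: "entry list list" where
  "grundy_table =
    [[Xor,   Xor1,  Xor,   Val 2, Xor1,  Xor,   Val 0, Xor1,  Xor,   Xor1],
     [Xor1,  Xor1,  Xor1,  Val 2, Xor1,  Xor1,  Val 0, Xor1,  Xor1,  Xor1],
     [Xor,   Xor1,  Xor,   Val 3, Xor1,  Xor,   Val 1, Xor1,  Xor,   Xor1],
     [Val 2, Val 2, Val 3, Val 0, Val 3, Val 0, Val 1, Val 1, Val 1, Val 0],
     [Xor1,  Xor1,  Xor1,  Val 3, Xor1,  Xor1,  Val 1, Xor1,  Xor1,  Xor1],
     [Xor,   Xor1,  Xor,   Val 0, Xor1,  Xor,   Val 2, Xor1,  Xor,   Xor1],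
     [Val 0, Val 0, Val 1, Val 1, Val 1, Val 2, Val 2, Val 2, Val 3, Val 3],
     [Xor1,  Xor1,  Xor1,  Val 1, Xor1,  Xor1,  Val 2, Val 0, Xor1,  Val 1],
     [Xor,   Xor1,  Xor,   Val 1, Xor1,  Xor,   Val 3, Xor1,  Xor,   Xor1],
     [Xor1,  Xor1,  Xor1,  Val 0, Xor1,  Xor1,  Val 3, Val 1, Xor1,  Val 0]]"

end

theory Submission
  imports Defs
begin

text \<open>
  Only the residues of the path lengths modulo 3 matter: the numbers of paths with residue 1 and
  with residue 2 determine one of ten classes, and the pair of classes determines the value of
  the bistar, for paths of arbitrary lengths. Shortening a path leads to a class that differs from the
  old one in every column of the table, so no option has the value of the position; and for every
  class the options that are always available realise all smaller values. Induction on the number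
  of vertices does the rest, once the few moves that delete a center and the stars
  with at most two paths, which are paths themselves, are treated separately.
\<close>

section \<open>Moves in connected induced subgraphs\<close>

text \<open>Equivalence under \<open>\<sim>\<^sub>2\<close> is tested against stars with paths of
  any length, so bistars have to be evaluated for all lengths from the outset. Residues modulo 3
  appear because a move on a path takes one or two vertices off its end, as in the subtraction game
  with moves 1 and 2. The residue always changes, but it may also grow, as from 0 to 2; hence
  classes are compared for every change of the residue of one path, in both directions. The
  exceptional rows have a simple source. With the empty star, P_1 or S_1 on one side, the bistar is
  just the other star with one more path of 1, 2 or 3 vertices; these are rows 1, 3 and 6 of the
  table, counted from 0. Among bistars with two nonempty sides, only those with P_1 or S_1 as a side
  allow a center to be deleted. The obstacle for the mex is that the class of a star does not
  determine which classes it can be shortened to. Therefore \<open>reached\<close> may have several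
  entries for one class, and the finite checks run over all pairs of entries.\<close>

definition ind :: "'a rel \<Rightarrow> 'a set \<Rightarrow> 'a pair_pre_digraph" where
  "ind E W = \<lparr> pverts = W, parcs = E \<inter> W \<times> W \<rparr>"

lemma ind_simps [simp]: "pverts (ind E W) = W" "parcs (ind E W) = E \<inter> W \<times> W"
  by (simp_all add: ind_def)

definition conn :: "'a rel \<Rightarrow> 'a set \<Rightarrow> bool" where
  "conn E W \<longleftrightarrow> W \<noteq> {} \<and> (\<forall>u\<in>W. \<forall>v\<in>W. (u, v) \<in> rtrancl_on W E)"

text \<open>A walk that starts in \<open>B\<close> and ends outside must use an edge across the cut.
  The later arguments about disconnection choose a suitable \<open>B\<close>, such as a leg or one
  half of a bistar.\<close>

lemma conn_cross:
  assumes "conn E W" "u \<in> W \<inter> B" "v \<in> W - B"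
  obtains x y where "x \<in> W \<inter> B" "y \<in> W - B" "(x, y) \<in> E"
proof -
  have "(u, v) \<in> rtrancl_on W E"
    using assms by (auto simp: conn_def)
  then have "v \<in> B \<or> (\<exists>x y. x \<in> W \<inter> B \<and> y \<in> W - B \<and> (x, y) \<in> E)"
    by (induction rule: rtrancl_on_induct) (use assms(2) in blast)+
  with assms(3) that show ?thesis
    by blast
qed

text \<open>Passing to parents decreases \<open>m\<close>, so every vertex reaches the root;
  symmetry supplies the way back.\<close>

lemma conn_rootI:
  fixes m :: "'a \<Rightarrow> nat"
  assumes "sym E" "r \<in> W"
    and parent: "\<And>w. w \<in> W \<Longrightarrow> w \<noteq> r \<Longrightarrow> \<exists>p\<in>W. m p < m w \<and> (w, p) \<in> E"
  shows "conn E W"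
proof -
  have reach: "(w, r) \<in> rtrancl_on W E" if "w \<in> W" for w
    using that
  proof (induction "m w" arbitrary: w rule: less_induct)
    case less
    show ?case
    proof (cases "w = r")
      case False
      with parent less.prems obtain p where "p \<in> W" "m p < m w" "(w, p) \<in> E"
        by blast
      with less show ?thesis
        by (blast intro: converse_rtrancl_on_into_rtrancl_on)
    qed (use less in auto)
  qed
  have "(r, w) \<in> rtrancl_on W E" if "w \<in> W" for w
    using rtrancl_on_converseI[OF reach[OF that]] \<open>sym E\<close> by (simp add: sym_conv_converse_eq)
  with reach assms(2) show ?thesis
    by (auto simp: conn_def intro: rtrancl_on_trans)
qed

lemma connected_ind:
  assumes "sym E"
  shows "connected (with_proj (ind E W)) \<longleftrightarrow> conn E W"
proof -
  have sym: "parcs (mk_symmetric (with_proj (ind E W))) = E \<inter> W \<times> W"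
    using assms by (auto simp: parcs_mk_symmetric ind_def sym_def)
  have "(u, v) \<in> rtrancl_on W (E \<inter> W \<times> W) \<longleftrightarrow> (u, v) \<in> rtrancl_on W E" for u v
  proof
    assume "(u, v) \<in> rtrancl_on W E"
    then show "(u, v) \<in> rtrancl_on W (E \<inter> W \<times> W)"
      by (induction rule: rtrancl_on_induct) (auto intro: rtrancl_on_into_rtrancl_on)
  next
    assume "(u, v) \<in> rtrancl_on W (E \<inter> W \<times> W)"
    then show "(u, v) \<in> rtrancl_on W E"
      by (induction rule: rtrancl_on_induct) (auto intro: rtrancl_on_into_rtrancl_on)
  qed
  then show ?thesis
    unfolding connected_def strongly_connected_def conn_def reachable_def
    by (simp add: sym)
qed

lemma induce_ind: "Y \<subseteq> W \<Longrightarrow> with_proj (ind E W) \<restriction> Y = with_proj (ind E Y)"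
  by (auto simp: induce_subgraph_def with_proj_def ind_def)

lemma wf_ind: "wf_digraph (with_proj (ind E W))"
  by unfold_locales (auto simp: ind_def)

text \<open>The component \<open>H\<close> in a move can thus be forgotten, because every option of
  a connected position is again connected or empty.\<close>

lemma max_subgraph_connected:
  assumes "wf_digraph G" "connected G"
  shows "pre_digraph.max_subgraph G connected H \<longleftrightarrow> H = G"
proof -
  have refl: "subgraph G G"
    using assms by (auto simp: subgraph_def compatible_def)
  have eq: "H = G" if "subgraph G H" "subgraph H G" for H
    using that by (intro pre_digraph.equality) (auto simp: subgraph_def compatible_def)
  show ?thesis
  proof
    assume "pre_digraph.max_subgraph G connected H"
    then have "subgraph H G" "G \<noteq> H \<and> subgraph H G \<longrightarrow> \<not> (subgraph G G \<and> connected G)"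
      unfolding pre_digraph.max_subgraph_def by simp_all
    with assms(2) refl show "H = G"
      by auto
  next
    assume "H = G"
    with assms(2) refl eq show "pre_digraph.max_subgraph G connected H"
      unfolding pre_digraph.max_subgraph_def by blast
  qed
qed

text \<open>Moves are recorded by the vertex set that remains. Inside one fixed relation, an option
  is then a position of the same form.\<close>

definition option_of :: "'a rel \<Rightarrow> 'a set \<Rightarrow> 'a set \<Rightarrow> bool" where
  "option_of E W Y \<longleftrightarrow> Y \<subseteq> W \<and> (Y = {} \<or> conn E Y) \<and>
     ((\<exists>v. W - Y = {v}) \<or> (\<exists>u v. W - Y = {u, v} \<and> (u, v) \<in> E))"

lemma move033_ind_iff:
  assumes "sym E" "conn E W"
  shows "move033 (with_proj (ind E W)) G' \<longleftrightarrow>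
    (\<exists>X\<subseteq>W. ((\<exists>v. X = {v}) \<or> (\<exists>u v. X = {u, v} \<and> (u, v) \<in> E)) \<and>
      (W - X = {} \<or> conn E (W - X)) \<and> G' = with_proj (ind E (W - X)))"
proof -
  have max: "pre_digraph.max_subgraph (with_proj (ind E W)) connected H \<longleftrightarrow> H = with_proj (ind E W)" for H
    using assms by (intro max_subgraph_connected wf_ind) (simp add: connected_ind)
  have one_point: "(\<exists>H X. H = a \<and> P H X) \<longleftrightarrow> (\<exists>X. P a X)" for a :: 'c and P :: "'c \<Rightarrow> 'd \<Rightarrow> bool"
    by blast
  have edge: "X \<subseteq> W \<Longrightarrow> (\<exists>u v. X = {u, v} \<and> (u, v) \<in> E \<inter> W \<times> W) \<longleftrightarrow> (\<exists>u v. X = {u, v} \<and> (u, v) \<in> E)" for X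
    by auto
  have "move033 (with_proj (ind E W)) G' \<longleftrightarrow>
    (\<exists>X. X \<subseteq> W \<and> ((\<exists>v. X = {v}) \<or> (\<exists>u v. X = {u, v} \<and> (u, v) \<in> E \<inter> W \<times> W)) \<and>
      (W - X = {} \<or> conn E (W - X)) \<and> G' = with_proj (ind E (W - X)))"
    unfolding move033_def max connected_ind[OF assms(1), symmetric] one_point
    by (simp only: with_proj_simps ind_simps induce_ind[OF Diff_subset])
  also have "\<dots> \<longleftrightarrow> (\<exists>X\<subseteq>W. ((\<exists>v. X = {v}) \<or> (\<exists>u v. X = {u, v} \<and> (u, v) \<in> E)) \<and>
      (W - X = {} \<or> conn E (W - X)) \<and> G' = with_proj (ind E (W - X)))"
    using edge by (intro ex_cong1 conj_cong refl) simp
  finally show ?thesis .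
qed

lemma move033_ind:
  assumes "sym E" "conn E W"
  shows "{G'. move033 (with_proj (ind E W)) G'} = (\<lambda>Y. with_proj (ind E Y)) ` {Y. option_of E W Y}"
    (is "?L = ?R")
proof (intro set_eqI iffI)
  fix G' assume "G' \<in> ?L"
  then obtain X where X: "X \<subseteq> W" "(\<exists>v. X = {v}) \<or> (\<exists>u v. X = {u, v} \<and> (u, v) \<in> E)"
    "W - X = {} \<or> conn E (W - X)" "G' = with_proj (ind E (W - X))"
    unfolding mem_Collect_eq move033_ind_iff[OF assms] by blast
  moreover from X(1) have "W - (W - X) = X"
    by auto
  ultimately have "option_of E W (W - X)"
    unfolding option_of_def by simp
  with X(4) show "G' \<in> ?R"
    by simp
next
  fix G' assume "G' \<in> ?R"
  then obtain Y where Y: "option_of E W Y" "G' = with_proj (ind E Y)"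
    by blast
  then have "W - (W - Y) = Y"
    by (auto simp: option_of_def)
  with Y have "W - Y \<subseteq> W \<and> ((\<exists>v. W - Y = {v}) \<or> (\<exists>u v. W - Y = {u, v} \<and> (u, v) \<in> E)) \<and>
      (W - (W - Y) = {} \<or> conn E (W - (W - Y))) \<and> G' = with_proj (ind E (W - (W - Y)))"
    by (simp add: option_of_def)
  then show "G' \<in> ?L"
    unfolding mem_Collect_eq move033_ind_iff[OF assms] by blast
qed

section \<open>Grundy values of induced subgraphs\<close>

definition gval :: "'a rel \<Rightarrow> 'a set \<Rightarrow> nat" where
  "gval E W = grundy (with_proj (ind E W))"

lemma gval_mex:
  assumes "sym E" "conn E W" "finite W"
  shows "gval E W = mex (gval E ` {Y. option_of E W Y})"
  unfolding gval_def using assms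
  by (subst grundy.simps) (simp add: move033_ind image_image)

text \<open>A \<open>connected\<close> graph is nonempty, so the empty graph has no component to
  move in.\<close>

lemma gval_empty [simp]: "gval E {} = 0"
proof -
  have "\<not> move033 (with_proj (ind E {})) G'" for G'
    by (auto simp: move033_def pre_digraph.max_subgraph_def connected_def strongly_connected_def
        subgraph_def)
  then have "{G'. move033 (with_proj (ind E {})) G'} = {}"
    by blast
  then have "mex (grundy ` {G'. move033 (with_proj (ind E {})) G'}) = 0"
    by (simp only: mex_def) simp
  then show ?thesis
    unfolding gval_def by (subst grundy.simps) simp
qed

lemma mex_eqI:
  assumes "n \<notin> A" "\<And>k. k < n \<Longrightarrow> k \<in> A"
  shows "mex A = n"
  unfolding mex_def using assms by (intro Least_equality) (auto simp: not_less[symmetric])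

lemma gval_eqI:
  assumes "sym E" "conn E W" "finite W"
    and "\<And>Y. option_of E W Y \<Longrightarrow> gval E Y \<noteq> n"
    and "\<And>k. k < n \<Longrightarrow> \<exists>Y. option_of E W Y \<and> gval E Y = k"
  shows "gval E W = n"
  unfolding gval_mex[OF assms(1-3)] using assms(4,5) by (intro mex_eqI) blast+

lemma option_of_card: "option_of E W Y \<Longrightarrow> finite W \<Longrightarrow> card Y < card W"
  by (rule psubset_card_mono) (auto simp: option_of_def)

section \<open>Invariance under isomorphism\<close>

lemma conn_image:
  assumes "conn E W" and edge: "\<And>u v. u \<in> W \<Longrightarrow> v \<in> W \<Longrightarrow> (u, v) \<in> E \<Longrightarrow> (h u, h v) \<in> E'"
  shows "conn E' (h ` W)"
proof -
  have "(h u, h v) \<in> rtrancl_on (h ` W) E'" if "(u, v) \<in> rtrancl_on W E" for u v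
    using that
    by (induction rule: rtrancl_on_induct) (auto intro: rtrancl_on_into_rtrancl_on edge)
  with assms(1) show ?thesis
    by (auto simp: conn_def)
qed

text \<open>Edges need only be preserved, so the lemma applies to an isomorphism and to its inverse
  separately.\<close>

lemma option_of_image:
  assumes "option_of E W Y" "inj_on h W"
    and edge: "\<And>u v. u \<in> W \<Longrightarrow> v \<in> W \<Longrightarrow> (u, v) \<in> E \<Longrightarrow> (h u, h v) \<in> E'"
  shows "option_of E' (h ` W) (h ` Y)"
proof -
  have Y: "Y \<subseteq> W" "Y = {} \<or> conn E Y"
    using assms(1) by (auto simp: option_of_def)
  have diff: "h ` W - h ` Y = h ` (W - Y)"
    using inj_on_image_set_diff[OF assms(2), of W Y] Y(1) by simp
  have "h ` Y = {} \<or> conn E' (h ` Y)"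
    using Y by (auto intro!: conn_image edge)
  moreover have "(\<exists>v. h ` (W - Y) = {v}) \<or> (\<exists>u v. h ` (W - Y) = {u, v} \<and> (u, v) \<in> E')"
  proof -
    consider v where "W - Y = {v}" | u v where "W - Y = {u, v}" "(u, v) \<in> E"
      using assms(1) by (auto simp: option_of_def)
    then show ?thesis
    proof cases
      case 2
      then have "u \<in> W" "v \<in> W"
        by auto
      with 2 edge show ?thesis
        by (metis image_insert image_empty)
    qed simp
  qed
  ultimately show ?thesis
    using Y(1) by (simp add: option_of_def diff image_mono)
qed

lemma gval_iso:
  assumes "sym E" "sym E'" "finite W" "conn E W" "inj_on h W"
    and "\<And>u v. u \<in> W \<Longrightarrow> v \<in> W \<Longrightarrow> (h u, h v) \<in> E' \<longleftrightarrow> (u, v) \<in> E"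
  shows "gval E' (h ` W) = gval E W"
  using assms(3-)
proof (induction "card W" arbitrary: W rule: less_induct)
  case less
  let ?g = "inv_into W h"
  have conn': "conn E' (h ` W)"
    using less.prems by (intro conn_image) auto
  have IH: "gval E' (h ` Y) = gval E Y" if "option_of E W Y" for Y
  proof (cases "Y = {}")
    case False
    with that have "Y \<subseteq> W" "conn E Y"
      by (auto simp: option_of_def)
    with less.prems show ?thesis
      by (intro less.hyps option_of_card[OF that]) (auto intro: finite_subset inj_on_subset)
  qed simp
  have gh: "?g ` h ` W = W"
    using less.prems(3) by simp
  have "{Z. option_of E' (h ` W) Z} = (`) h ` {Y. option_of E W Y}" (is "?L = ?R")
  proof
    show "?R \<subseteq> ?L"
      using less.prems by (auto intro!: option_of_image)
    show "?L \<subseteq> ?R"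
    proof
      fix Z assume "Z \<in> ?L"
      then have Z: "option_of E' (h ` W) Z"
        by simp
      have "option_of E (?g ` h ` W) (?g ` Z)"
        using Z
      proof (rule option_of_image)
        fix u v assume "u \<in> h ` W" "v \<in> h ` W" "(u, v) \<in> E'"
        then show "(?g u, ?g v) \<in> E"
          using less.prems(3,4) by (auto simp: inv_into_f_f)
      qed (auto intro: inj_on_inv_into)
      moreover have "h ` ?g ` Z = Z"
        using Z by (intro image_inv_into_cancel) (auto simp: option_of_def)
      ultimately show "Z \<in> ?R"
        unfolding gh by (metis imageI mem_Collect_eq)
    qed
  qed
  then have "gval E' ` {Z. option_of E' (h ` W) Z} = gval E ` {Y. option_of E W Y}"
    using IH by (auto simp: image_image)
  then show ?case
    using less.prems assms(1,2) conn' by (simp add: gval_mex)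
qed

section \<open>Paths\<close>

text \<open>Infinite in both directions, so that a star with two paths can be laid out around
  0.\<close>

definition line :: "int rel" where
  "line = {(i, j). \<bar>i - j\<bar> = 1}"

lemma sym_line: "sym line"
  by (auto simp: line_def sym_def)

lemma conn_line_iff: "conn line {a..b} \<longleftrightarrow> a \<le> b"
proof
  assume "a \<le> b"
  show "conn line {a..b}"
  proof (rule conn_rootI[where r = a and m = "\<lambda>i. nat (i - a)"])
    fix w assume "w \<in> {a..b}" "w \<noteq> a"
    then show "\<exists>p\<in>{a..b}. nat (p - a) < nat (w - a) \<and> (w, p) \<in> line"
      by (intro bexI[of _ "w - 1"]) (auto simp: line_def)
  qed (use \<open>a \<le> b\<close> in \<open>auto simp: sym_line\<close>)
qed (auto simp: conn_def)

lemma conn_line_convex: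
  assumes "conn line Y" "x \<in> Y" "z \<in> Y" "x \<le> y" "y \<le> z"
  shows "y \<in> Y"
proof (rule ccontr)
  assume "y \<notin> Y"
  with assms have "x \<in> Y \<inter> {..y}" "z \<in> Y - {..y}"
    by (auto simp: order_le_less)
  with assms(1) obtain u v where "u \<in> Y \<inter> {..y}" "v \<in> Y - {..y}" "(u, v) \<in> line"
    by (rule conn_cross)
  then have "u = y"
    by (auto simp: line_def)
  with \<open>u \<in> _\<close> \<open>y \<notin> Y\<close> show False
    by auto
qed

text \<open>The remainder is convex, so vertices are lost only at the two ends.\<close>

lemma option_of_line:
  assumes "option_of line {a..b} Y"
  obtains c d where "Y = {c..d}" "a \<le> c" "d \<le> b" "(c - a) + (b - d) \<in> {1, 2}" "c \<le> d + 1"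
proof -
  have Y: "Y \<subseteq> {a..b}" and conn: "Y = {} \<or> conn line Y"
    and X: "(\<exists>v. {a..b} - Y = {v}) \<or> (\<exists>u. {a..b} - Y = {u, u + 1})"
  proof -
    show "Y \<subseteq> {a..b}" "Y = {} \<or> conn line Y"
      using assms by (auto simp: option_of_def)
    have "v = u + 1 \<or> u = v + 1" if "(u, v) \<in> line" for u v
      using that by (auto simp: line_def)
    then show "(\<exists>v. {a..b} - Y = {v}) \<or> (\<exists>u. {a..b} - Y = {u, u + 1})"
      using assms unfolding option_of_def by (metis insert_commute)
  qed
  have fin: "finite Y"
    using Y by (rule finite_subset) simp
  have card: "card ({a..b} - Y) \<in> {1, 2}"
    using X by auto
  show ?thesis
  proof (cases "Y = {}")
    case True
    then have "b - a + 1 \<in> {1, 2}"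
      using card by auto
    \<comment> \<open>The empty remainder is written as \<open>{a..a - 1}\<close>, which makes the
      number of lost vertices come out as \<open>b - a + 1\<close>.\<close>
    with True show ?thesis
      by (intro that[of a "a - 1"]) auto
  next
    case False
    define c d where "c = Min Y" and "d = Max Y"
    have cd: "c \<in> Y" "d \<in> Y" "\<And>y. y \<in> Y \<Longrightarrow> c \<le> y \<and> y \<le> d"
      using False fin by (auto simp: c_def d_def)
    have "conn line Y"
      using conn False by simp
    have Y_eq: "Y = {c..d}"
    proof (intro equalityI subsetI)
      fix y assume "y \<in> {c..d}"
      then show "y \<in> Y"
        using conn_line_convex[OF \<open>conn line Y\<close> cd(1,2)] by simp
    qed (use cd(3) in auto)
    have "c \<le> d" "a \<le> c" "d \<le> b"
      using cd Y by auto
    then have "card ({a..b} - Y) = nat ((c - a) + (b - d))"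
      unfolding Y_eq by (subst card_Diff_subset) auto
    with card have "(c - a) + (b - d) \<in> {1, 2}"
      by auto
    with Y_eq \<open>a \<le> c\<close> \<open>d \<le> b\<close> \<open>c \<le> d\<close> show ?thesis
      by (intro that) auto
  qed
qed

text \<open>A path is a heap of the subtraction game with moves 1 and 2; it does not matter from
  which end the vertices are taken.\<close>

lemma gval_line: "gval line {a..b} = nat (b - a + 1) mod 3"
proof (induction "nat (b - a + 1)" arbitrary: a b rule: less_induct)
  case less
  show ?case
  proof (cases "a \<le> b")
    case True
    let ?n = "nat (b - a + 1)"
    show ?thesis
    proof (rule gval_eqI)
      show "sym line" "conn line {a..b}" "finite {a..b}"
        using True by (simp_all add: sym_line conn_line_iff)
    next
      fix Y assume "option_of line {a..b} Y"
      then obtain c d where cd: "Y = {c..d}" "a \<le> c" "d \<le> b" "(c - a) + (b - d) \<in> {1, 2}" "c \<le> d + 1"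
        by (rule option_of_line)
      then have "nat (d - c + 1) < ?n"
        by auto
      then have "gval line Y = nat (d - c + 1) mod 3"
        unfolding cd(1) by (rule less.hyps)
      moreover have "nat (d - c + 1) + 1 = ?n \<or> nat (d - c + 1) + 2 = ?n"
        using cd True by auto
      moreover have "m mod 3 \<noteq> n mod 3" if "m + 1 = n \<or> m + 2 = n" for m n :: nat
        using that by presburger
      ultimately show "gval line Y \<noteq> ?n mod 3"
        by metis
    next
      fix k assume k: "k < ?n mod 3"
      \<comment> \<open>Taking \<open>e\<close> vertices from the right end lowers the residue to
        exactly \<open>k\<close>; residues are at most 2, so this is a legal amount.\<close>
      define e where "e = ?n mod 3 - k"
      have e: "e = 1 \<or> e = 2" "e \<le> ?n" "(?n - e) mod 3 = k"
      proof -
        have m: "?n mod 3 < 3" "?n mod 3 \<le> ?n"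
          by simp_all
        show "e = 1 \<or> e = 2" "e \<le> ?n"
          using k m by (auto simp: e_def)
        have "?n - e = ?n - ?n mod 3 + k"
          using k m by (auto simp: e_def)
        moreover have "(?n - ?n mod 3 + k) mod 3 = k mod 3"
          by (simp add: minus_mod_eq_mult_div)
        ultimately show "(?n - e) mod 3 = k"
          using k m by simp
      qed
      let ?Y = "{a..b - int e}"
      have "{a..b} - ?Y = {b} \<or> {a..b} - ?Y = {b - 1, b}"
        using e(1,2) True by auto
      moreover have "(b - 1, b) \<in> line"
        by (simp add: line_def)
      ultimately have "option_of line {a..b} ?Y"
        unfolding option_of_def conn_line_iff by auto
      moreover have "gval line ?Y = k"
      proof -
        have "nat (b - int e - a + 1) = ?n - e"
          using e by linarith
        moreover have "gval line ?Y = nat (b - int e - a + 1) mod 3"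
          using e True by (intro less.hyps) auto
        ultimately show ?thesis
          using e by simp
      qed
      ultimately show "\<exists>Y. option_of line {a..b} Y \<and> gval line Y = k"
        by blast
    qed
  qed simp
qed

section \<open>Paths attached to a core\<close>

text \<open>
  All stars and bistars are induced subgraphs of one infinite graph, so that shortening a path
  needs no relabelling. \<open>Core 0\<close>, \<open>Core 1\<close>, \<open>Core 2\<close> are the left center, the middle vertex and the
  right center; the side of a label is \<open>True\<close> for paths attached to the right center.
\<close>

datatype label = Label (side: bool) (pos: "nat \<times> nat")

datatype vertex = Core nat | Leg label nat

definition ctr :: "bool \<Rightarrow> nat" where
  "ctr s = (if s then 2 else 0)"

fun adj :: "vertex \<Rightarrow> vertex \<Rightarrow> bool" where
  "adj (Core k) (Core m) \<longleftrightarrow> (k, m) \<in> {(0, 1), (1, 0), (1, 2), (2, 1)}"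
| "adj (Core k) (Leg x j) \<longleftrightarrow> k = ctr (side x) \<and> j = 1"
| "adj (Leg x j) (Core k) \<longleftrightarrow> k = ctr (side x) \<and> j = 1"
| "adj (Leg x i) (Leg y j) \<longleftrightarrow> x = y \<and> (1 \<le> i \<and> j = i + 1 \<or> 1 \<le> j \<and> i = j + 1)"

definition leg_rel :: "vertex rel" where
  "leg_rel = {(u, v). adj u v}"

lemma leg_rel_iff [simp]: "(u, v) \<in> leg_rel \<longleftrightarrow> adj u v"
  by (simp add: leg_rel_def)

lemma sym_leg_rel: "sym leg_rel"
proof (rule symI)
  fix u v assume "(u, v) \<in> leg_rel"
  then show "(v, u) \<in> leg_rel"
    by (cases u; cases v) auto
qed

definition leg_verts :: "nat set \<Rightarrow> (label \<Rightarrow> nat) \<Rightarrow> vertex set" where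
  "leg_verts K f = Core ` K \<union> {Leg x j | x j. 1 \<le> j \<and> j \<le> f x}"

lemma leg_verts_iff [simp]:
  "Core k \<in> leg_verts K f \<longleftrightarrow> k \<in> K"
  "Leg x j \<in> leg_verts K f \<longleftrightarrow> 1 \<le> j \<and> j \<le> f x"
  unfolding leg_verts_def by blast+

lemma vertex_set_eqI:
  assumes "\<And>k. Core k \<in> A \<longleftrightarrow> Core k \<in> B" "\<And>x j. Leg x j \<in> A \<longleftrightarrow> Leg x j \<in> B"
  shows "A = B"
proof (rule set_eqI)
  show "v \<in> A \<longleftrightarrow> v \<in> B" for v
    using assms by (cases v) auto
qed

text \<open>Length 0 stands for an absent leg, so a function on all labels can describe finitely
  many legs. A leg that is present needs its center for connectedness.\<close>

definition attached :: "nat set \<Rightarrow> (label \<Rightarrow> nat) \<Rightarrow> bool" where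
  "attached K f \<longleftrightarrow> finite {x. 0 < f x} \<and> (\<forall>x. 0 < f x \<longrightarrow> ctr (side x) \<in> K)"

lemma attached_upd: "attached K f \<Longrightarrow> n \<le> f x \<Longrightarrow> attached K (f(x := n))"
  unfolding attached_def
  by (intro conjI) (auto elim!: rev_finite_subset split: if_splits dest: less_le_trans)

lemma finite_leg_verts:
  assumes "finite K" "attached K f"
  shows "finite (leg_verts K f)"
proof -
  have "leg_verts K f \<subseteq> Core ` K \<union> (\<Union>x\<in>{x. 0 < f x}. Leg x ` {..f x})"
    unfolding leg_verts_def by force
  then show ?thesis
    by (rule finite_subset) (use assms in \<open>auto simp: attached_def\<close>)
qed

text \<open>The three core sets belong to a star around the right center, to such a star with the
  middle vertex, and to a bistar.\<close>

lemma conn_leg_verts: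
  assumes K: "K \<in> {{2}, {1, 2}, {0, 1, 2}}" and att: "attached K f"
  shows "conn leg_rel (leg_verts K f)"
proof (rule conn_rootI)
  \<comment> \<open>The offset 3 places all leg vertices above the core vertices, so the first
    vertex of a leg can have its center as parent.\<close>
  let ?m = "\<lambda>v. case v of Core k \<Rightarrow> 2 - k | Leg x j \<Rightarrow> 3 + j"
  show "Core 2 \<in> leg_verts K f"
    using K by auto
  fix w assume w: "w \<in> leg_verts K f" "w \<noteq> Core 2"
  show "\<exists>p\<in>leg_verts K f. ?m p < ?m w \<and> (w, p) \<in> leg_rel"
  proof (cases w)
    case (Core k)
    with w K have "k \<in> {0, 1}" "Suc k \<in> K"
      by auto
    with Core show ?thesis
      by (intro bexI[of _ "Core (Suc k)"]) auto
  next
    case (Leg x j)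
    show ?thesis
    proof (cases "j = 1")
      case True
      then show ?thesis
        using Leg w att by (intro bexI[of _ "Core (ctr (side x))"]) (auto simp: attached_def)
    next
      case False
      then show ?thesis
        using Leg w by (intro bexI[of _ "Leg x (j - 1)"]) auto
    qed
  qed
qed (rule sym_leg_rel)

text \<open>The only edge that leaves a leg runs from its first vertex to its center.\<close>

lemma conn_leg_attached:
  assumes "conn leg_rel Y" "Leg x j \<in> Y" "Core k \<in> Y"
  shows "Core (ctr (side x)) \<in> Y"
proof -
  from assms obtain u v where "u \<in> Y \<inter> range (Leg x)" "v \<in> Y - range (Leg x)" "(u, v) \<in> leg_rel"
    by (elim conn_cross[where B = "range (Leg x)" and u = "Leg x j" and v = "Core k"]) auto
  then show ?thesis
    by (cases v) auto
qed

text \<open>The part of a leg beyond \<open>i\<close> can be left only through the vertex at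
  \<open>i\<close>.\<close>

lemma conn_leg_down:
  assumes "conn leg_rel Y" "Leg x j \<in> Y" "Core k \<in> Y" "1 \<le> i" "i \<le> j"
  shows "Leg x i \<in> Y"
proof (rule ccontr)
  assume i: "Leg x i \<notin> Y"
  let ?B = "Leg x ` {i<..}"
  have "Leg x j \<in> Y \<inter> ?B" "Core k \<in> Y - ?B"
    using assms i by (auto simp: order_le_less)
  with assms(1) obtain u v where uv: "u \<in> Y \<inter> ?B" "v \<in> Y - ?B" "(u, v) \<in> leg_rel"
    by (rule conn_cross)
  then obtain l where l: "u = Leg x l" "i < l"
    by auto
  show False
  proof (cases v)
    case (Core k)
    with uv(3) l \<open>1 \<le> i\<close> show ?thesis
      by simp
  next
    case (Leg y m)
    with uv(3) l have "y = x" "m = l + 1 \<or> l = m + 1"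
      by auto
    moreover have "\<not> i < m"
      using uv(2) Leg \<open>y = x\<close> by auto
    ultimately have "v = Leg x i"
      using l Leg by auto
    with uv(2) i show ?thesis
      by auto
  qed
qed

text \<open>Such a remainder meets every leg in an initial segment. This turns moves into arithmetic
  on lengths.\<close>

lemma conn_subset_leg_verts:
  assumes att: "attached K f" and Y: "Y \<subseteq> leg_verts K f" "conn leg_rel Y" "Core k \<in> Y"
  obtains K' f' where "Y = leg_verts K' f'" "K' \<subseteq> K" "\<forall>x. f' x \<le> f x" "attached K' f'"
proof -
  define K' where "K' = {k. Core k \<in> Y}"
  define f' where "f' x = card {j. Leg x j \<in> Y}" for x
  have "{j. Leg x j \<in> Y} = {1..f' x}" for x
  proof -
    let ?J = "{j. Leg x j \<in> Y}"
    have J: "?J \<subseteq> {1..f x}"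
      using Y(1) by auto
    then have fin: "finite ?J"
      by (rule finite_subset) simp
    show ?thesis
    proof (cases "?J = {}")
      case False
      then have "Max ?J \<in> ?J"
        using fin by (rule Max_in[rotated])
      then have "?J = {1..Max ?J}"
        using conn_leg_down[OF Y(2) _ Y(3)] J fin by (auto intro: Max_ge)
      then obtain n where n: "?J = {1..n}"
        by blast
      then have "f' x = n"
        by (simp only: f'_def) simp
      with n show ?thesis
        by simp
    qed (simp add: f'_def)
  qed
  then have legs: "Leg x j \<in> Y \<longleftrightarrow> 1 \<le> j \<and> j \<le> f' x" for x j
    by (auto simp: set_eq_iff)
  have Y_eq: "Y = leg_verts K' f'"
    by (rule vertex_set_eqI) (simp_all add: K'_def legs)
  have le: "f' x \<le> f x" for x
  proof (cases "f' x = 0")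
    case False
    then have "Leg x (f' x) \<in> Y"
      by (simp add: legs)
    with Y(1) show ?thesis
      by auto
  qed simp
  have att': "attached K' f'"
    unfolding attached_def
  proof (intro conjI allI impI)
    show "finite {x. 0 < f' x}"
      using att by (auto simp: attached_def elim!: rev_finite_subset intro: less_le_trans le)
    fix x assume "0 < f' x"
    then have "Leg x (f' x) \<in> Y"
      by (simp add: legs)
    then show "ctr (side x) \<in> K'"
      using conn_leg_attached Y by (auto simp: K'_def)
  qed
  show ?thesis
    by (rule that[OF Y_eq _ _ att']) (use le Y(1) in \<open>auto simp: K'_def\<close>)
qed

text \<open>The core is untouched, so the deleted vertices lie on legs; two of them are adjacent and
  hence on the same leg.\<close>

lemma option_of_leg_verts_leg:
  assumes "option_of leg_rel (leg_verts K f) (leg_verts K f')" "\<forall>x. f' x \<le> f x"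
  obtains x d where "d \<in> {1, 2}" "d \<le> f x" "f' = f(x := f x - d)"
proof -
  let ?X = "leg_verts K f - leg_verts K f'"
  have core: "Core k \<notin> ?X" for k
    by simp
  obtain x where x: "?X \<noteq> {}" "?X \<subseteq> range (Leg x)" "finite ?X" "card ?X \<le> 2"
  proof -
    consider v where "?X = {v}" | u v where "?X = {u, v}" "adj u v"
      using assms(1) by (auto simp: option_of_def)
    then show ?thesis
    proof cases
      case 1
      with core obtain x j where "v = Leg x j"
        by (metis insertI1 vertex.exhaust)
      with 1 that[of x] show ?thesis
        by simp
    next
      case 2
      then have "u \<in> ?X" "v \<in> ?X"
        by simp_all
      then obtain x i y j where "u = Leg x i" "v = Leg y j"
        using core by (cases u; cases v) blast+
      with 2 that[of x] show ?thesis
        by (auto simp: card_insert_if)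
    qed
  qed
  have "Leg x ` {f' x<..f x} \<subseteq> ?X"
    by auto
  from card_mono[OF x(3) this] x(4) have "card (Leg x ` {f' x<..f x}) \<le> 2"
    by linarith
  then have d: "f x - f' x \<le> 2"
    by (simp add: card_image inj_on_def)
  obtain j where "Leg x j \<in> ?X"
    using x(1,2) by blast
  then have "f' x < f x"
    by auto
  have "f' y = f y" if "y \<noteq> x" for y
  proof (rule ccontr)
    assume "f' y \<noteq> f y"
    then have "f' y < f y"
      using assms(2)[rule_format, of y] by simp
    then have "Leg y (f y) \<in> ?X"
      by auto
    with x(2) that show False
      by blast
  qed
  then have "f' = f(x := f x - (f x - f' x))"
    using assms(2)[rule_format, of x] by auto
  with d \<open>f' x < f x\<close> show ?thesis
    by (intro that[of "f x - f' x" x]) auto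
qed

lemma option_of_leg_verts_legI:
  assumes "K \<in> {{2}, {1, 2}, {0, 1, 2}}" "attached K f" "d \<in> {1, 2}" "d \<le> f x"
  shows "option_of leg_rel (leg_verts K f) (leg_verts K (f(x := f x - d)))"
proof -
  let ?Y = "leg_verts K (f(x := f x - d))"
  have diff: "leg_verts K f - ?Y = (if d = 1 then {Leg x (f x)} else {Leg x (f x - 1), Leg x (f x)})"
    using assms(3,4) by (intro vertex_set_eqI) auto
  have adj: "d = 2 \<Longrightarrow> adj (Leg x (f x - 1)) (Leg x (f x))"
    using assms(4) by auto
  have "?Y \<subseteq> leg_verts K f"
  proof
    fix v assume "v \<in> ?Y"
    then show "v \<in> leg_verts K f"
      by (cases v) (auto split: if_splits)
  qed
  moreover have "conn leg_rel ?Y"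
    using assms by (intro conn_leg_verts attached_upd) auto
  moreover have "(\<exists>v. leg_verts K f - ?Y = {v}) \<or> (\<exists>u v. leg_verts K f - ?Y = {u, v} \<and> (u, v) \<in> leg_rel)"
  proof (cases "d = 1")
    case True
    with diff show ?thesis
      by simp
  next
    case False
    with assms(3) adj diff have "leg_verts K f - ?Y = {Leg x (f x - 1), Leg x (f x)} \<and>
        (Leg x (f x - 1), Leg x (f x)) \<in> leg_rel"
      by simp
    then show ?thesis
      by blast
  qed
  ultimately show ?thesis
    unfolding option_of_def by blast
qed

section \<open>Classes of leg functions\<close>

text \<open>
  The class, as an index into \<^const>\<open>classes\<close>, of a star with \<open>a\<close> paths of residue 1 and \<open>b\<close> paths of
  residue 2 modulo 3.
\<close>

definition cls :: "nat \<Rightarrow> nat \<Rightarrow> nat" where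
  "cls a b =
    (if a = 0 \<and> b = 0 \<or> a = 1 \<and> b = 1 \<or> a = 0 \<and> b = 3 then 3
     else if a = 1 \<and> b = 0 \<or> a = 0 \<and> b = 2 then 6
     else if a = 0 \<and> b = 1 then 1
     else if b = 0 then (if even a then 1 else 4)
     else if b = 1 then (if even a then 7 else 9)
     else if b = 2 then (if even a then 4 else 1)
     else if b = 3 then (if even a then 9 else 7)
     else if even b then (if even a then 0 else 2)
     else (if even a then 5 else 8))"

definition class_value :: "nat list" where
  "class_value = [0, 0, 1, 1, 1, 2, 2, 2, 3, 3]"

text \<open>The table of the statement with \<open>Xor\<close> and \<open>Xor1\<close> evaluated at
  \<open>class_value\<close>, which makes comparisons of rows finite computations. Rows 1, 3 and 6
  hold the values of the column's star with one more path of residue 1, 2 and 0; row 6 is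
  \<open>class_value\<close> itself.\<close>

definition class_table :: "nat list list" where
  "class_table =
    [[0, 1, 1, 2, 0, 2, 0, 3, 3, 2],
     [1, 1, 0, 2, 0, 3, 0, 3, 2, 2],
     [1, 0, 0, 3, 1, 3, 1, 2, 2, 3],
     [2, 2, 3, 0, 3, 0, 1, 1, 1, 0],
     [0, 0, 1, 3, 1, 2, 1, 2, 3, 3],
     [2, 3, 3, 0, 2, 0, 2, 1, 1, 0],
     [0, 0, 1, 1, 1, 2, 2, 2, 3, 3],
     [3, 3, 2, 1, 2, 1, 2, 0, 0, 1],
     [3, 2, 2, 1, 3, 1, 3, 0, 0, 1],
     [2, 2, 3, 0, 3, 0, 3, 1, 1, 0]]"

text \<open>A symmetric list that contains the classes of any two stars differing in the residue of
  a single path. Shortening a long path by 1 or 2 reaches both other residues, whatever the residue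
  was.\<close>

definition neighbours :: "(nat \<times> nat) list" where
  "neighbours =
    [(0, 2), (0, 3), (0, 5), (0, 7), (0, 8), (0, 9), (1, 3), (1, 4), (1, 6), (1, 7), (1, 9),
     (2, 0), (2, 5), (2, 7), (2, 8), (2, 9), (3, 0), (3, 1), (3, 6), (3, 7), (4, 1), (4, 7),
     (4, 9), (5, 0), (5, 2), (5, 8), (6, 1), (6, 3), (7, 0), (7, 1), (7, 2), (7, 3), (7, 4),
     (7, 9), (8, 0), (8, 2), (8, 5), (9, 0), (9, 1), (9, 2), (9, 4), (9, 7)]"

text \<open>
  For every star of class \<open>c\<close> other than $P_1$ and $S_1$ there is an entry \<open>(c, m)\<close> such that the star
  can be shortened to every class in \<open>m\<close>.
\<close>

definition reached :: "(nat \<times> nat list) list" where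
  "reached =
    [(0, [3, 7]), (0, [5, 8]), (0, [2, 7, 9]), (1, [6]), (1, [4]), (2, [0, 5, 8]), (2, [0,
     7, 9]), (3, [1, 6]), (4, [1]), (5, [0, 2]), (6, [1, 3]), (7, [1, 3, 4]), (7, [1, 4,
     9]), (8, [0, 2, 5]), (9, [1, 4, 7])]"

section \<open>Finite checks on the tables\<close>

lemma cls_less_10: "cls a b < 10"
  by (simp add: cls_def)

lemma list_all_uptD: "list_all P [0..<n] \<Longrightarrow> i < n \<Longrightarrow> P i"
  by (simp add: list_all_iff)

lemma tab_entry_value:
  "i < 10 \<Longrightarrow> j < 10 \<Longrightarrow> class_table ! i ! j = entry_value (grundy_table ! i ! j) (class_value ! i) (class_value ! j)"
proof -
  have "list_all (\<lambda>i. list_all (\<lambda>j. class_table ! i ! j = entry_value (grundy_table ! i ! j) (class_value ! i) (class_value ! j)) [0..<10]) [0..<10]"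
    by code_simp
  then show "i < 10 \<Longrightarrow> j < 10 \<Longrightarrow> class_table ! i ! j = entry_value (grundy_table ! i ! j) (class_value ! i) (class_value ! j)"
    by (simp add: list_all_iff)
qed

lemma tab_commute:
  assumes "i < 10" "j < 10"
  shows "class_table ! i ! j = class_table ! j ! i"
proof -
  have "list_all (\<lambda>i. list_all (\<lambda>j. class_table ! i ! j = class_table ! j ! i) [0..<10]) [0..<10]"
    by code_simp
  with assms show ?thesis
    by (simp add: list_all_iff)
qed

text \<open>This is the half of the mex condition that forbids options with the value of the
  position: the first part serves stars, the second bistars.\<close>

lemma neighbours_differ:
  assumes "(c, c') \<in> set neighbours"
  shows "class_value ! c \<noteq> class_value ! c'" and "k < 10 \<Longrightarrow> class_table ! c ! k \<noteq> class_table ! c' ! k"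
proof -
  have "list_all (\<lambda>(c, c'). class_value ! c \<noteq> class_value ! c' \<and> list_all (\<lambda>k. class_table ! c ! k \<noteq> class_table ! c' ! k) [0..<10]) neighbours"
    by code_simp
  with assms show "class_value ! c \<noteq> class_value ! c'" and "k < 10 \<Longrightarrow> class_table ! c ! k \<noteq> class_table ! c' ! k"
    by (auto simp: list_all_iff)
qed

lemma reached_star:
  assumes "(c, m) \<in> set reached" "v < class_value ! c"
  shows "\<exists>k\<in>set m. class_value ! k = v"
proof -
  have "list_all (\<lambda>(c, m). list_all (\<lambda>v. list_ex (\<lambda>k. class_value ! k = v) m) [0..<class_value ! c]) reached"
    by code_simp
  with assms show ?thesis
    by (fastforce simp: list_all_iff list_ex_iff)
qed

text \<open>Every smaller value comes from shortening a path on the left or on the right. The pairs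
  are pairs of entries, not of classes, since stars of one class can have different options.\<close>

lemma reached_bistar:
  assumes "(c, m) \<in> set reached" "(c', m') \<in> set reached" "v < class_table ! c ! c'"
  shows "(\<exists>k\<in>set m. class_table ! k ! c' = v) \<or> (\<exists>k\<in>set m'. class_table ! c ! k = v)"
proof -
  have "list_all (\<lambda>(c, m). list_all (\<lambda>(c', m'). list_all (\<lambda>v.
      list_ex (\<lambda>k. class_table ! k ! c' = v) m \<or> list_ex (\<lambda>k. class_table ! c ! k = v) m') [0..<class_table ! c ! c']) reached) reached"
    by code_simp
  with assms show ?thesis
    by (fastforce simp: list_all_iff list_ex_iff)
qed

text \<open>The left star is P_1 and has no path to shorten. Deleting it leaves the right star with
  a pendant vertex, which is row 1; deleting it together with the middle vertex leaves the bare
  right star.\<close>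

lemma reached_bistar_center:
  assumes "(c, m) \<in> set reached" "v < class_table ! 3 ! c"
  shows "v = class_table ! 1 ! c \<or> v = class_value ! c \<or> (\<exists>k\<in>set m. class_table ! 3 ! k = v)"
proof -
  have "list_all (\<lambda>(c, m). list_all (\<lambda>v.
      v = class_table ! 1 ! c \<or> v = class_value ! c \<or> list_ex (\<lambda>k. class_table ! 3 ! k = v) m) [0..<class_table ! 3 ! c]) reached"
    by code_simp
  with assms show ?thesis
    by (fastforce simp: list_all_iff list_ex_iff)
qed

text \<open>Beyond small counts only parities matter, which makes a finite check of
  \<open>cls\<close> possible.\<close>

lemma cls_periodic:
  "2 \<le> a \<Longrightarrow> cls (Suc (Suc a)) b = cls a b" "4 \<le> b \<Longrightarrow> cls a (Suc (Suc b)) = cls a b"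
  by (simp_all add: cls_def)

text \<open>Excludes the move that deletes P_1 and the middle vertex as an option of equal
  value.\<close>

lemma gv_neq_tab_center: "c < 10 \<Longrightarrow> class_value ! c \<noteq> class_table ! 3 ! c"
proof -
  have "list_all (\<lambda>c. class_value ! c \<noteq> class_table ! 3 ! c) [0..<10]"
    by code_simp
  then show "c < 10 \<Longrightarrow> class_value ! c \<noteq> class_table ! 3 ! c"
    by (simp add: list_all_iff)
qed

text \<open>Paths of residue 0 are not counted, so the three lines are the exchanges of residues 0
  and 1, 0 and 2, 1 and 2.\<close>

lemma cls_neighbours:
  "(cls a b, cls (Suc a) b) \<in> set neighbours" "(cls (Suc a) b, cls a b) \<in> set neighbours"
  "(cls a b, cls a (Suc b)) \<in> set neighbours" "(cls a (Suc b), cls a b) \<in> set neighbours"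
  "(cls (Suc a) b, cls a (Suc b)) \<in> set neighbours" "(cls a (Suc b), cls (Suc a) b) \<in> set neighbours"
  by (simp_all add: cls_def neighbours_def)

text \<open>A bistar with an empty side is the other star with one more path of one vertex; hence
  row 1 is the row of \<open>Empty\<close>.\<close>

lemma gv_one_more_leg: "class_value ! cls (Suc a) b = class_table ! 1 ! cls a b"
  by (simp add: cls_def class_value_def class_table_def)
text \<open>Uses only paths whose presence the counts guarantee: residue 1 drops to 0, residue 2
  drops to 0 or 1. The excluded counts are those of P_1 and S_1.\<close>

lemma cls_reached:
  assumes "a \<noteq> 0 \<or> b \<noteq> 0" "\<not> (a = 1 \<and> b = 0)"
  shows "\<exists>m. (cls a b, m) \<in> set reached \<and>
    (\<forall>k\<in>set m. a \<noteq> 0 \<and> k = cls (a - 1) b \<or>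
      b \<noteq> 0 \<and> (k = cls a (b - 1) \<or> k = cls (a + 1) (b - 1)))"
  using assms
proof (induction "a + b" arbitrary: a b rule: less_induct)
  case less
  \<comment> \<open>The bounds exceed those of \<open>cls_periodic\<close> by 3: the count drops by
    2 to reach the induction hypothesis and by 1 more in an option, and periodicity must still hold
    there.\<close>
  consider "5 \<le> a" | "7 \<le> b" | "a < 5" "b < 7"
    by linarith
  then show ?case
  proof cases
    case 1
    then obtain a' where "a = Suc (Suc (Suc a'))" "2 \<le> a'"
      by (auto dest!: le_Suc_ex)
    then show ?thesis
      using less.hyps[of "Suc a'" b] by (simp add: cls_periodic)
  next
    case 2
    then obtain b' where "b = Suc (Suc (Suc b'))" "4 \<le> b'"
      by (auto dest!: le_Suc_ex)
    then show ?thesis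
      using less.hyps[of a "Suc b'"] by (simp add: cls_periodic)
  next
    case 3
    have "list_all (\<lambda>a. list_all (\<lambda>b. a = 0 \<and> b = 0 \<or> a = 1 \<and> b = 0 \<or>
        list_ex (\<lambda>(c, m). c = cls a b \<and> list_all (\<lambda>k. a \<noteq> 0 \<and> k = cls (a - 1) b \<or>
          b \<noteq> 0 \<and> (k = cls a (b - 1) \<or> k = cls (a + 1) (b - 1))) m) reached) [0..<7]) [0..<5]"
      by code_simp
    from list_all_uptD[OF list_all_uptD[OF this 3(1)] 3(2)] less.prems show ?thesis
      by (auto simp: list_ex_iff list_all_iff)
  qed
qed

section \<open>Residue counts of length functions and the effect of shortening\<close>

definition count_mod3 :: "nat \<Rightarrow> ('p \<Rightarrow> nat) \<Rightarrow> nat" where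
  "count_mod3 r g = card {p. g p mod 3 = r}"

definition leg_class :: "('p \<Rightarrow> nat) \<Rightarrow> nat" where
  "leg_class g = cls (count_mod3 1 g) (count_mod3 2 g)"

definition shorten :: "('p \<Rightarrow> nat) \<Rightarrow> ('p \<Rightarrow> nat) \<Rightarrow> bool" where
  "shorten g g' \<longleftrightarrow> (\<exists>p d. d \<in> {1, 2} \<and> d \<le> g p \<and> g' = g(p := g p - d))"

lemma cl_less_10: "leg_class g < 10"
  by (simp add: leg_class_def cls_less_10)

lemma cl_zero [simp]: "leg_class (\<lambda>_. 0) = 3"
  by (simp add: leg_class_def count_mod3_def cls_def)

text \<open>Residue 0 has to be excluded because absent legs have it too.\<close>

lemma finite_residue:
  fixes g :: "'p \<Rightarrow> nat"
  assumes "finite {p. 0 < g p}" "0 < r"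
  shows "finite {p. g p mod 3 = r}"
  using assms(1) by (rule rev_finite_subset) (use assms(2) in \<open>auto intro: gr0I\<close>)

lemma cnt_pos:
  fixes g :: "'p \<Rightarrow> nat"
  assumes "finite {p. 0 < g p}" "0 < r" "g p mod 3 = r"
  shows "0 < count_mod3 r g"
  unfolding count_mod3_def using finite_residue[OF assms(1,2)] assms(3) by (auto simp: card_gt_0_iff)

lemma cnt_posD: "0 < count_mod3 r g \<Longrightarrow> \<exists>p. g p mod 3 = r"
  unfolding count_mod3_def by (auto dest: card_ge_0_finite intro: ccontr)

lemma cnt_upd:
  fixes g :: "'p \<Rightarrow> nat"
  assumes "finite {p. 0 < g p}" "0 < r"
  shows "count_mod3 r (g(p := n)) + (if g p mod 3 = r then 1 else 0) = count_mod3 r g + (if n mod 3 = r then 1 else 0)"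
proof -
  let ?A = "{q. q \<noteq> p \<and> g q mod 3 = r}"
  have fin: "finite ?A"
    using finite_residue[OF assms] by (rule rev_finite_subset) auto
  have "{q. g q mod 3 = r} = (if g p mod 3 = r then insert p ?A else ?A)"
    "{q. (g(p := n)) q mod 3 = r} = (if n mod 3 = r then insert p ?A else ?A)"
    by auto
  with fin show ?thesis
    by (simp add: count_mod3_def)
qed

lemma mod3_diff1:
  fixes n :: nat
  assumes "Suc 0 \<le> n"
  shows "(n - Suc 0) mod 3 = (if n mod 3 = 0 then 2 else n mod 3 - 1)"
proof -
  obtain k where "n = Suc k"
    using assms by (cases n) auto
  then show ?thesis
    by (simp add: mod_Suc)
qed

lemma mod3_diff2:
  fixes n :: nat
  assumes "2 \<le> n"
  shows "(n - 2) mod 3 = (if n mod 3 = 0 then 1 else if n mod 3 = 1 then 2 else 0)"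
proof -
  obtain k where k: "n = Suc (Suc k)"
    using assms by (metis One_nat_def Suc_1 Suc_le_D Suc_le_mono)
  consider "k mod 3 = 0" | "k mod 3 = 1" | "k mod 3 = 2"
    by linarith
  then show ?thesis
    by cases (simp_all add: k mod_Suc)
qed

text \<open>Subtracting 1 or 2 always changes the residue, which leaves the six changes covered by
  \<open>cls_neighbours\<close>.\<close>

lemma cl_upd_neighbours:
  assumes fin: "finite {p. 0 < g p}" and d: "d \<in> {1, 2}" "d \<le> g p"
  shows "(leg_class g, leg_class (g(p := g p - d))) \<in> set neighbours"
proof -
  let ?g' = "g(p := g p - d)"
  have count_mod3: "count_mod3 r ?g' + (if g p mod 3 = r then 1 else 0) = count_mod3 r g + (if (g p - d) mod 3 = r then 1 else 0)"
    if "0 < r" for r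
    by (rule cnt_upd[OF fin that])
  note c1 = count_mod3[of 1, simplified] and c2 = count_mod3[of 2, simplified]
  consider (z1) "g p mod 3 = 0" "(g p - d) mod 3 = 2" | (z2) "g p mod 3 = 0" "(g p - d) mod 3 = 1"
    | (o1) "g p mod 3 = 1" "(g p - d) mod 3 = 0" | (o2) "g p mod 3 = 1" "(g p - d) mod 3 = 2"
    | (t1) "g p mod 3 = 2" "(g p - d) mod 3 = 1" | (t2) "g p mod 3 = 2" "(g p - d) mod 3 = 0"
  proof -
    have "g p mod 3 = 0 \<or> g p mod 3 = 1 \<or> g p mod 3 = 2"
      by linarith
    with d that show thesis
      by (elim insertE disjE) (simp_all add: mod3_diff1 mod3_diff2)
  qed
  then show ?thesis
  proof cases
    case z1
    then show ?thesis
      using c1 c2 cls_neighbours by (simp add: leg_class_def)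
  next
    case z2
    then show ?thesis
      using c1 c2 cls_neighbours by (simp add: leg_class_def)
  next
    case o1
    with c1 c2 have "count_mod3 1 g = Suc (count_mod3 1 ?g')" "count_mod3 2 g = count_mod3 2 ?g'"
      by simp_all
    then show ?thesis
      using cls_neighbours by (simp add: leg_class_def)
  next
    case o2
    with c1 c2 have "count_mod3 1 g = Suc (count_mod3 1 ?g')" "count_mod3 2 ?g' = Suc (count_mod3 2 g)"
      by simp_all
    then show ?thesis
      using cls_neighbours by (simp add: leg_class_def)
  next
    case t1
    with c1 c2 have "count_mod3 1 ?g' = Suc (count_mod3 1 g)" "count_mod3 2 g = Suc (count_mod3 2 ?g')"
      by simp_all
    then show ?thesis
      using cls_neighbours by (simp add: leg_class_def)
  next
    case t2
    with c1 c2 have "count_mod3 1 ?g' = count_mod3 1 g" "count_mod3 2 g = Suc (count_mod3 2 ?g')"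
      by simp_all
    then show ?thesis
      using cls_neighbours by (simp add: leg_class_def)
  qed
qed

lemma shorten_neighbours:
  assumes "finite {p. 0 < g p}" "shorten g g'"
  shows "(leg_class g, leg_class g') \<in> set neighbours"
  using assms(2) unfolding shorten_def by (elim exE conjE) (simp only: cl_upd_neighbours[OF assms(1)])

text \<open>For the counts of P_1 and S_1 the residues alone give too few options. Any other star
  with these counts has a path of length divisible by 3, or a path of residue 1 with at least 4
  vertices, and that path supplies the options. For all remaining counts \<open>cls_reached\<close>
  suffices.\<close>

lemma shorten_reached:
  fixes g :: "'p \<Rightarrow> nat"
  assumes fin: "finite {p. 0 < g p}" and "g \<noteq> (\<lambda>_. 0)" and single: "\<And>p. g \<noteq> (\<lambda>_. 0)(p := 1)"
  shows "\<exists>m. (leg_class g, m) \<in> set reached \<and> (\<forall>k\<in>set m. \<exists>g'. shorten g g' \<and> leg_class g' = k)"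
proof -
  have cl_upd: "\<exists>g'. shorten g g' \<and> leg_class g' = cls a b"
    if "d \<in> {1, 2}" "d \<le> g p" "a + (if g p mod 3 = 1 then 1 else 0) = count_mod3 1 g + (if (g p - d) mod 3 = 1 then 1 else 0)"
      "b + (if g p mod 3 = 2 then 1 else 0) = count_mod3 2 g + (if (g p - d) mod 3 = 2 then 1 else 0)" for p d a b
  proof (intro exI conjI)
    let ?g' = "g(p := g p - d)"
    show "shorten g ?g'"
      using that(1,2) by (auto simp: shorten_def)
    have "count_mod3 1 ?g' = a" "count_mod3 2 ?g' = b"
      using cnt_upd[OF fin, of 1 p "g p - d"] cnt_upd[OF fin, of 2 p "g p - d"] that(3,4) by auto
    then show "leg_class ?g' = cls a b"
      by (simp add: leg_class_def)
  qed
  consider (zero) "count_mod3 1 g = 0" "count_mod3 2 g = 0" | (one) "count_mod3 1 g = 1" "count_mod3 2 g = 0"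
    | (other) "count_mod3 1 g \<noteq> 0 \<or> count_mod3 2 g \<noteq> 0" "\<not> (count_mod3 1 g = 1 \<and> count_mod3 2 g = 0)"
    by linarith
  then show ?thesis
  proof cases
    case zero
    obtain p where p: "0 < g p"
      using assms(2) by auto
    have "g p mod 3 \<noteq> 1" "g p mod 3 \<noteq> 2"
      using zero cnt_pos[OF fin, of 1 p] cnt_pos[OF fin, of 2 p] by auto
    then have p3: "g p mod 3 = 0" "3 \<le> g p"
      using p by presburger+
    have "\<exists>g'. shorten g g' \<and> leg_class g' = cls 0 1"
      using p3 zero by (intro cl_upd[of 1 p]) (simp_all add: mod3_diff1 mod3_diff2)
    moreover have "\<exists>g'. shorten g g' \<and> leg_class g' = cls 1 0"
      using p3 zero by (intro cl_upd[of 2 p]) (simp_all add: mod3_diff1 mod3_diff2)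
    ultimately show ?thesis
      using zero by (intro exI[of _ "[1, 6]"]) (simp add: leg_class_def cls_def reached_def)
  next
    case one
    then obtain p where p: "g p mod 3 = 1"
      using cnt_posD[of 1 g] by auto
    have "(\<exists>g'. shorten g g' \<and> leg_class g' = 3) \<and> (\<exists>g'. shorten g g' \<and> leg_class g' = 1)"
    proof (cases "g p = 1")
      case False
      with p have "2 \<le> g p"
        by presburger
      have "\<exists>g'. shorten g g' \<and> leg_class g' = cls 0 0"
        using \<open>2 \<le> g p\<close> p one by (intro cl_upd[of 1 p]) (simp_all add: mod3_diff1 mod3_diff2)
      moreover have "\<exists>g'. shorten g g' \<and> leg_class g' = cls 0 1"
        using \<open>2 \<le> g p\<close> p one by (intro cl_upd[of 2 p]) (simp_all add: mod3_diff1 mod3_diff2)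
      ultimately show ?thesis
        by (simp add: cls_def)
    next
      case True
      \<comment> \<open>The star is not S_1, so a second leg exists; the counts leave only residue 0
        for it.\<close>
      obtain q where q: "q \<noteq> p" "0 < g q"
      proof (rule ccontr)
        assume "\<not> thesis"
        then have "g = (\<lambda>_. 0)(p := 1)"
          using that True by (auto simp: fun_eq_iff)
        with single show False
          by blast
      qed
      have "g q mod 3 \<noteq> 2"
        using one cnt_pos[OF fin, of 2 q] by auto
      moreover have "g q mod 3 \<noteq> 1"
      proof
        assume "g q mod 3 = 1"
        with p have "{p, q} \<subseteq> {p. g p mod 3 = 1}"
          by auto
        from card_mono[OF finite_residue[OF fin] this] q one show False
          by (simp add: count_mod3_def)
      qed
      ultimately have q3: "g q mod 3 = 0" "3 \<le> g q"
        using q(2) by presburger+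
      have "\<exists>g'. shorten g g' \<and> leg_class g' = cls 1 1"
        using q3 one by (intro cl_upd[of 1 q]) (simp_all add: mod3_diff1 mod3_diff2)
      moreover have "\<exists>g'. shorten g g' \<and> leg_class g' = cls 2 0"
        using q3 one by (intro cl_upd[of 2 q]) (simp_all add: mod3_diff1 mod3_diff2)
      ultimately show ?thesis
        by (simp add: cls_def)
    qed
    then show ?thesis
      using one by (intro exI[of _ "[1, 3]"]) (simp add: leg_class_def cls_def reached_def)
  next
    case other
    have one: "\<exists>g'. shorten g g' \<and> leg_class g' = cls (count_mod3 1 g - 1) (count_mod3 2 g)" if nz: "count_mod3 1 g \<noteq> 0"
    proof -
      obtain p where "g p mod 3 = 1"
        using nz cnt_posD[of 1 g] by auto
      moreover from this have "1 \<le> g p"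
        by presburger
      ultimately show ?thesis
        using nz by (intro cl_upd[of 1 p]) (simp_all add: mod3_diff1)
    qed
    have two: "\<exists>g'. shorten g g' \<and> leg_class g' = cls (count_mod3 1 g) (count_mod3 2 g - 1)"
      "\<exists>g'. shorten g g' \<and> leg_class g' = cls (count_mod3 1 g + 1) (count_mod3 2 g - 1)" if nz: "count_mod3 2 g \<noteq> 0"
    proof -
      obtain p where "g p mod 3 = 2"
        using nz cnt_posD[of 2 g] by auto
      moreover from this have "2 \<le> g p"
        by presburger
      ultimately show "\<exists>g'. shorten g g' \<and> leg_class g' = cls (count_mod3 1 g) (count_mod3 2 g - 1)"
        "\<exists>g'. shorten g g' \<and> leg_class g' = cls (count_mod3 1 g + 1) (count_mod3 2 g - 1)"
        using nz by (intro cl_upd[of 2 p], simp_all add: mod3_diff2)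
          (intro cl_upd[of 1 p], simp_all add: mod3_diff1)
    qed
    obtain m where m: "(leg_class g, m) \<in> set reached"
      "\<forall>k\<in>set m. count_mod3 1 g \<noteq> 0 \<and> k = cls (count_mod3 1 g - 1) (count_mod3 2 g) \<or>
        count_mod3 2 g \<noteq> 0 \<and> (k = cls (count_mod3 1 g) (count_mod3 2 g - 1) \<or> k = cls (count_mod3 1 g + 1) (count_mod3 2 g - 1))"
      using cls_reached[OF other] unfolding leg_class_def by blast
    with one two show ?thesis
      by (intro exI[of _ m] conjI ballI) auto
  qed
qed

section \<open>Values of stars\<close>

text \<open>A single star is placed on the right, with \<open>zero_legs\<close> on the left.\<close>

definition join :: "(nat \<times> nat \<Rightarrow> nat) \<Rightarrow> (nat \<times> nat \<Rightarrow> nat) \<Rightarrow> label \<Rightarrow> nat" where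
  "join g h x = (if side x then h (pos x) else g (pos x))"

abbreviation zero_legs :: "nat \<times> nat \<Rightarrow> nat" where
  "zero_legs \<equiv> \<lambda>_. 0"

lemma label_eq_iff: "x = y \<longleftrightarrow> side x = side y \<and> pos x = pos y"
  by (cases x; cases y) auto

lemma join_upd:
  "(join g h)(Label True p := n) = join g (h(p := n))"
  "(join g h)(Label False p := n) = join (g(p := n)) h"
  by (auto simp: join_def fun_eq_iff label_eq_iff)

lemma finite_join:
  assumes "finite {p. 0 < g p}" "finite {p. 0 < h p}"
  shows "finite {x. 0 < join g h x}"
proof -
  have "{x. 0 < join g h x} \<subseteq> Label False ` {p. 0 < g p} \<union> Label True ` {p. 0 < h p}"
  proof
    fix x assume "x \<in> {x. 0 < join g h x}"
    then show "x \<in> Label False ` {p. 0 < g p} \<union> Label True ` {p. 0 < h p}"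
      by (cases x) (auto simp: join_def split: if_splits)
  qed
  then show ?thesis
    by (rule finite_subset) (use assms in simp)
qed

lemma attached_join:
  assumes "finite {p. 0 < g p}" "finite {p. 0 < h p}" "0 \<in> K \<or> g = zero_legs" "2 \<in> K \<or> h = zero_legs"
  shows "attached K (join g h)"
  unfolding attached_def using finite_join[OF assms(1,2)] assms(3,4)
  by (auto simp: join_def ctr_def split: if_splits)

lemma attached_star: "finite {p. 0 < h p} \<Longrightarrow> attached {2} (join zero_legs h)"
  by (rule attached_join) auto

lemma finite_shorten: "finite {p. 0 < g p} \<Longrightarrow> shorten g g' \<Longrightarrow> finite {p. 0 < g' p}"
  unfolding shorten_def by (auto elim!: rev_finite_subset split: if_splits)

lemma shortenI: "d \<in> {1, 2} \<Longrightarrow> d \<le> g p \<Longrightarrow> shorten g (g(p := g p - d))"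
  unfolding shorten_def by blast

lemma option_of_join:
  assumes "option_of leg_rel (leg_verts K (join g h)) (leg_verts K f')" "\<forall>x. f' x \<le> join g h x"
  obtains g' where "shorten g g'" "f' = join g' h" | h' where "shorten h h'" "f' = join g h'"
proof -
  obtain x d where d: "d \<in> {1, 2}" "d \<le> join g h x" "f' = (join g h)(x := join g h x - d)"
    using assms by (rule option_of_leg_verts_leg)
  show ?thesis
  proof (cases x)
    case (Label s p)
    show ?thesis
    proof (cases s)
      case True
      with d(2) Label have le: "d \<le> h p"
        by (simp add: join_def)
      have "f' = join g (h(p := h p - d))"
        unfolding d(3) using True Label by (simp add: join_upd) (simp add: join_def)
      with shortenI[of d h p, OF d(1) le] show ?thesis
        by (rule that(2))
    next
      case False
      with d(2) Label have le: "d \<le> g p"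
        by (simp add: join_def)
      have "f' = join (g(p := g p - d)) h"
        unfolding d(3) using False Label by (simp add: join_upd) (simp add: join_def)
      with shortenI[of d g p, OF d(1) le] show ?thesis
        by (rule that(1))
    qed
  qed
qed

lemma option_of_joinI:
  assumes "K \<in> {{2}, {1, 2}, {0, 1, 2}}" "attached K (join g h)"
  shows "shorten g g' \<Longrightarrow> option_of leg_rel (leg_verts K (join g h)) (leg_verts K (join g' h))"
    and "shorten h h' \<Longrightarrow> option_of leg_rel (leg_verts K (join g h)) (leg_verts K (join g h'))"
proof -
  assume "shorten g g'"
  then obtain p d where "d \<in> {1, 2}" "d \<le> g p" "g' = g(p := g p - d)"
    by (auto simp: shorten_def)
  with option_of_leg_verts_legI[OF assms, of d "Label False p"] show "option_of leg_rel (leg_verts K (join g h)) (leg_verts K (join g' h))"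
    by (simp add: join_upd) (simp add: join_def)
next
  assume "shorten h h'"
  then obtain p d where "d \<in> {1, 2}" "d \<le> h p" "h' = h(p := h p - d)"
    by (auto simp: shorten_def)
  with option_of_leg_verts_legI[OF assms, of d "Label True p"] show "option_of leg_rel (leg_verts K (join g h)) (leg_verts K (join g h'))"
    by (simp add: join_upd) (simp add: join_def)
qed

text \<open>Such a star is a path through its center, which is placed at 0. Either length may be 0,
  so stars with fewer paths are included.\<close>

lemma star_two_legs:
  assumes "p \<noteq> q" and supp: "{r. 0 < h r} \<subseteq> {p, q}"
  shows "gval leg_rel (leg_verts {2} (join zero_legs h)) = (1 + h p + h q) mod 3"
proof -
  let ?W = "leg_verts {2} (join zero_legs h)"
  define \<phi> where "\<phi> v = (case v of Core _ \<Rightarrow> 0 | Leg x j \<Rightarrow> if pos x = p then int j else - int j)" for v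
  have fin: "finite {r. 0 < h r}"
    using supp by (rule finite_subset) simp
  have W: "v = Core 2 \<or> (\<exists>j. v = Leg (Label True p) j \<and> 1 \<le> j \<and> j \<le> h p) \<or>
      (\<exists>j. v = Leg (Label True q) j \<and> 1 \<le> j \<and> j \<le> h q)" if "v \<in> ?W" for v
  proof (cases v)
    case (Leg x j)
    with that have x: "side x" "1 \<le> j" "j \<le> h (pos x)"
      by (auto simp: join_def split: if_splits)
    with supp have "pos x = p \<or> pos x = q"
      by force
    with x Leg show ?thesis
      by (cases x) auto
  qed (use that in auto)
  have val: "\<phi> (Core 2) = 0" "\<phi> (Leg (Label True p) j) = int j" "\<phi> (Leg (Label True q) j) = - int j" for j
    using \<open>p \<noteq> q\<close> by (simp_all add: \<phi>_def)
  have "gval line (\<phi> ` ?W) = gval leg_rel ?W"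
  proof (rule gval_iso)
    show "finite ?W" "conn leg_rel ?W"
      using fin by (simp_all add: finite_leg_verts conn_leg_verts attached_star)
    show "inj_on \<phi> ?W"
    proof (rule inj_onI)
      fix u v assume "u \<in> ?W" "v \<in> ?W" "\<phi> u = \<phi> v"
      then show "u = v"
        using W[of u] W[of v] by (auto simp: val)
    qed
    fix u v assume "u \<in> ?W" "v \<in> ?W"
    then show "(\<phi> u, \<phi> v) \<in> line \<longleftrightarrow> (u, v) \<in> leg_rel"
      using W[of u] W[of v] \<open>p \<noteq> q\<close> by (auto simp: val line_def ctr_def)
  qed (rule sym_leg_rel sym_line)+
  moreover have "\<phi> ` ?W = {- int (h q)..int (h p)}"
  proof
    show "\<phi> ` ?W \<subseteq> {- int (h q)..int (h p)}"
      using W by (force simp: val)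
    show "{- int (h q)..int (h p)} \<subseteq> \<phi> ` ?W"
    proof
      fix i assume i: "i \<in> {- int (h q)..int (h p)}"
      consider "i = 0" | "0 < i" | "i < 0"
        by linarith
      then show "i \<in> \<phi> ` ?W"
      proof cases
        case 1
        then show ?thesis
          by (intro image_eqI[of _ _ "Core 2"]) (simp_all add: val)
      next
        case 2
        then show ?thesis
          using i by (intro image_eqI[of _ _ "Leg (Label True p) (nat i)"]) (auto simp: val join_def)
      next
        case 3
        then show ?thesis
          using i by (intro image_eqI[of _ _ "Leg (Label True q) (nat (- i))"]) (auto simp: val join_def)
      qed
    qed
  qed
  moreover have "nat (int (h p) - (- int (h q)) + 1) = 1 + h p + h q"
    by simp
  ultimately show ?thesis
    by (simp only: gval_line)
qed

text \<open>Both sides depend only on the two residues, which leaves nine cases.\<close>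

lemma cl_two_legs:
  assumes "p \<noteq> q" and supp: "{r. 0 < h r} \<subseteq> {p, q}"
  shows "class_value ! leg_class h = (1 + h p + h q) mod 3"
proof -
  have count_mod3: "count_mod3 r h = (if h p mod 3 = r then 1 else 0) + (if h q mod 3 = r then 1 else 0)" if "0 < r" for r
  proof -
    have "{x. h x mod 3 = r} = (if h p mod 3 = r then {p} else {}) \<union> (if h q mod 3 = r then {q} else {})"
      using supp that by (auto split: if_splits) (metis bot_nat_0.not_eq_extremum insertE mem_Collect_eq mod_0 singletonD subsetD)+
    with \<open>p \<noteq> q\<close> show ?thesis
      by (simp add: count_mod3_def)
  qed
  have mod: "(1 + h p + h q) mod 3 = (1 + h p mod 3 + h q mod 3) mod 3"
    by (intro mod_add_cong refl) simp_all
  have "h p mod 3 = 0 \<or> h p mod 3 = 1 \<or> h p mod 3 = 2" "h q mod 3 = 0 \<or> h q mod 3 = 1 \<or> h q mod 3 = 2"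
    by linarith+
  then show ?thesis
    unfolding mod leg_class_def by (elim disjE) (simp_all add: count_mod3 cls_def class_value_def)
qed


text \<open>A move that deletes the center takes at most one adjacent vertex with it. The first
  vertices of two legs then remain, and without the center nothing connects them.\<close>

lemma option_of_star_center:
  assumes opt: "option_of leg_rel (leg_verts {2} (join zero_legs h)) Y" and fin: "finite {p. 0 < h p}"
    and three: "3 \<le> card {p. 0 < h p}"
  shows "Core 2 \<in> Y"
proof (rule ccontr)
  assume center: "Core 2 \<notin> Y"
  let ?W = "leg_verts {2} (join zero_legs h)" and ?S = "{p. 0 < h p}"
  let ?v = "\<lambda>p. Leg (Label True p) 1"
  let ?T = "{p \<in> ?S. ?v p \<notin> Y}"
  have X: "finite (?W - Y)" "card (?W - Y) \<le> 2"
    using opt by (auto simp: option_of_def card_insert_if)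
  have "insert (Core 2) (?v ` ?T) \<subseteq> ?W - Y"
    using center by (auto simp: join_def)
  from card_mono[OF X(1) this] X(2) have "card (insert (Core 2) (?v ` ?T)) \<le> 2"
    by linarith
  moreover have "card (insert (Core 2) (?v ` ?T)) = Suc (card ?T)"
  proof -
    have "card (?v ` ?T) = card ?T"
      by (intro card_image inj_onI) simp
    moreover have "finite (?v ` ?T)" "Core 2 \<notin> ?v ` ?T"
      using fin by auto
    ultimately show ?thesis
      by simp
  qed
  ultimately have "card ?T \<le> 1"
    by simp
  moreover have "card (?S - ?T) = card ?S - card ?T"
    using fin by (intro card_Diff_subset) auto
  ultimately have "2 \<le> card (?S - ?T)"
    using three by linarith
  then obtain p q where pq: "p \<in> ?S - ?T" "q \<in> ?S - ?T" "p \<noteq> q"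
    using card_le_Suc0_iff_eq[of "?S - ?T"] fin by auto
  then have Y: "?v p \<in> Y" "?v q \<in> Y"
    by auto
  let ?B = "range (Leg (Label True p))"
  have "conn leg_rel Y"
    using opt Y by (auto simp: option_of_def)
  moreover have "?v p \<in> Y \<inter> ?B" "?v q \<in> Y - ?B"
    using Y pq(3) by auto
  ultimately obtain u v where "u \<in> Y \<inter> ?B" "v \<in> Y - ?B" "(u, v) \<in> leg_rel"
    by (rule conn_cross)
  then have "v = Core 2"
    by (cases v) (auto simp: ctr_def)
  with \<open>v \<in> Y - ?B\<close> center show False
    by simp
qed

text \<open>With three or more paths all options are shortenings, so \<open>neighbours\<close> and
  \<open>reached\<close> give the two halves of the mex condition. With at most two paths the center
  may be deletable, and the star is evaluated as a path.\<close>

lemma gval_star: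
  assumes "finite {p. 0 < h p}"
  shows "gval leg_rel (leg_verts {2} (join zero_legs h)) = class_value ! leg_class h"
  using assms
proof (induction "card (leg_verts {2} (join zero_legs h))" arbitrary: h rule: less_induct)
  case less
  let ?W = "leg_verts {2} (join zero_legs h)" and ?S = "{p. 0 < h p}"
  note att = attached_star[OF less.prems]
  have W: "finite ?W" "conn leg_rel ?W"
    using att by (simp_all add: finite_leg_verts conn_leg_verts)
  show ?case
  proof (cases "card ?S \<le> 2")
    case True
    obtain p q where "p \<noteq> q" "?S \<subseteq> {p, q}"
    proof -
      \<comment> \<open>Labels of absent legs fill the support up to exactly two.\<close>
      have "infinite (UNIV - ?S)"
        using less.prems by (simp add: finite_prod)
      from infinite_arbitrarily_large[OF this, of "2 - card ?S"]
      obtain A where "finite A \<and> card A = 2 - card ?S \<and> A \<subseteq> UNIV - ?S" ..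
      then have "card (?S \<union> A) = 2"
        using less.prems True by (subst card_Un_disjoint) auto
      then obtain p q where "?S \<union> A = {p, q}" "p \<noteq> q"
        unfolding card_2_iff by (elim exE conjE)
      then show ?thesis
        by (intro that[of p q]) blast+
    qed
    from star_two_legs[OF this] cl_two_legs[OF this] show ?thesis
      by simp
  next
    case False
    show ?thesis
    proof (rule gval_eqI[OF sym_leg_rel W(2,1)])
      fix Y assume opt: "option_of leg_rel ?W Y"
      then have Y: "Core 2 \<in> Y" "Y \<subseteq> ?W" "conn leg_rel Y"
        using option_of_star_center[OF opt less.prems] False by (auto simp: option_of_def)
      obtain K' f' where KF: "Y = leg_verts K' f'" "K' \<subseteq> {2}" "\<forall>x. f' x \<le> join zero_legs h x" "attached K' f'"
        using conn_subset_leg_verts[OF att Y(2,3,1)] .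
      with Y(1) have "K' = {2}"
        by auto
      with opt KF have "option_of leg_rel ?W (leg_verts {2} f')"
        by simp
      then obtain h' where h': "shorten h h'" "f' = join zero_legs h'"
      proof (rule option_of_join[OF _ KF(3)])
        fix g' assume "shorten zero_legs g'"
        then show thesis
          by (auto simp: shorten_def)
      qed
      have "gval leg_rel Y = class_value ! leg_class h'"
        using option_of_card[OF opt W(1)] finite_shorten[OF less.prems h'(1)]
        unfolding KF(1) h'(2) \<open>K' = {2}\<close> by (rule less.hyps)
      then show "gval leg_rel Y \<noteq> class_value ! leg_class h"
        using neighbours_differ(1)[OF shorten_neighbours[OF less.prems h'(1)]] by simp
    next
      fix k assume k: "k < class_value ! leg_class h"
      have nz: "h \<noteq> zero_legs" "h \<noteq> zero_legs(p := 1)" for p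
        using False by (auto simp: card_insert_if split: if_splits)
      obtain m where m: "(leg_class h, m) \<in> set reached" "\<forall>k\<in>set m. \<exists>h'. shorten h h' \<and> leg_class h' = k"
        using shorten_reached[OF less.prems nz] by blast
      from reached_star[OF m(1) k] obtain c where c: "c \<in> set m" "class_value ! c = k" ..
      from m(2)[rule_format, OF c(1)] obtain h' where "shorten h h' \<and> leg_class h' = c" ..
      with c(2) have h': "shorten h h'" "class_value ! leg_class h' = k"
        by simp_all
      have opt: "option_of leg_rel ?W (leg_verts {2} (join zero_legs h'))"
        using h'(1) att by (intro option_of_joinI) auto
      have "gval leg_rel (leg_verts {2} (join zero_legs h')) = class_value ! leg_class h'"
        using option_of_card[OF opt W(1)] finite_shorten[OF less.prems h'(1)] by (rule less.hyps)
      with opt h'(2) show "\<exists>Y. option_of leg_rel ?W Y \<and> gval leg_rel Y = k"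
        by blast
    qed
  qed
qed

text \<open>The middle vertex acts as one more path with a single vertex.\<close>

lemma gval_star_middle:
  assumes fin: "finite {p. 0 < h p}"
  shows "gval leg_rel (leg_verts {1, 2} (join zero_legs h)) = class_table ! 1 ! leg_class h"
proof -
  have "infinite (UNIV - {p. 0 < h p})"
    using fin by (simp add: finite_prod)
  then obtain p where p: "h p = 0"
    by (metis (mono_tags, lifting) Diff_iff finite.emptyI gr0I mem_Collect_eq ex_in_conv)
  let ?h = "h(p := 1)"
  let ?W = "leg_verts {2} (join zero_legs ?h)" and ?x = "Leg (Label True p) 1"
  have fin': "finite {p. 0 < ?h p}"
    by (rule finite_subset[of _ "insert p {p. 0 < h p}"]) (use fin in auto)
  have W: "finite ?W" "conn leg_rel ?W"
    by (rule finite_leg_verts[OF _ attached_star[OF fin']], simp) (rule conn_leg_verts[OF _ attached_star[OF fin']], simp)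
  \<comment> \<open>Without the left center, \<open>Core 1\<close> is adjacent to
    \<open>Core 2\<close> only, just like the vertex of the added leg at \<open>p\<close>.\<close>
  define \<phi> where "\<phi> v = (if v = ?x then Core 1 else v)" for v
  have Wx: "j = 1" if "Leg (Label True p) j \<in> ?W" for j
    using that by (simp add: join_def)
  have Wc: "k = 2" if "Core k \<in> ?W" for k
    using that by simp
  have adj_x: "adj ?x v \<longleftrightarrow> v = Core 2" "adj v ?x \<longleftrightarrow> v = Core 2" "adj (Core 1) v \<longleftrightarrow> v = Core 2" "adj v (Core 1) \<longleftrightarrow> v = Core 2"
    if "v \<in> ?W" for v
    using that Wx Wc by (cases v; auto simp: ctr_def join_def split: if_splits)+
  have iso: "gval leg_rel (\<phi> ` ?W) = gval leg_rel ?W"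
  proof (rule gval_iso[OF sym_leg_rel sym_leg_rel W])
    show "inj_on \<phi> ?W"
      by (rule inj_onI) (auto simp: \<phi>_def split: if_splits)
    fix u v assume "u \<in> ?W" "v \<in> ?W"
    then show "(\<phi> u, \<phi> v) \<in> leg_rel \<longleftrightarrow> (u, v) \<in> leg_rel"
      using adj_x[of u] adj_x[of v] by (auto simp: \<phi>_def)
  qed
  have image: "\<phi> ` ?W = leg_verts {1, 2} (join zero_legs h)"
  proof (rule vertex_set_eqI)
    have x: "?x \<in> ?W"
      by (simp add: join_def)
    show "Core k \<in> \<phi> ` ?W \<longleftrightarrow> Core k \<in> leg_verts {1, 2} (join zero_legs h)" for k
    proof -
      have "Core 1 \<in> \<phi> ` ?W" "Core 2 \<in> \<phi> ` ?W"
        using x by (auto simp: \<phi>_def image_iff intro: bexI[of _ "Core 2"])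
      moreover have "k = 1 \<or> k = 2" if "Core k \<in> \<phi> ` ?W"
        using that Wc by (auto simp: \<phi>_def split: if_splits)
      ultimately show ?thesis
        by auto
    qed
    fix y j
    have "Leg y j \<in> \<phi> ` ?W \<longleftrightarrow> Leg y j \<in> ?W \<and> Leg y j \<noteq> ?x"
      by (auto simp: \<phi>_def image_iff split: if_splits)
    also have "\<dots> \<longleftrightarrow> Leg y j \<in> leg_verts {1, 2} (join zero_legs h)"
      using p by (cases y) (auto simp: join_def)
    finally show "Leg y j \<in> \<phi> ` ?W \<longleftrightarrow> Leg y j \<in> leg_verts {1, 2} (join zero_legs h)" .
  qed
  have leg_class: "leg_class ?h = cls (Suc (count_mod3 1 h)) (count_mod3 2 h)"
    using cnt_upd[OF fin, of 1 p 1] cnt_upd[OF fin, of 2 p 1] p by (simp add: leg_class_def)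
  have "gval leg_rel (leg_verts {1, 2} (join zero_legs h)) = gval leg_rel ?W"
    using iso unfolding image .
  also have "\<dots> = class_value ! leg_class ?h"
    by (rule gval_star[OF fin'])
  also have "\<dots> = class_table ! 1 ! leg_class h"
    unfolding leg_class gv_one_more_leg leg_class_def[of h] ..
  finally show ?thesis .
qed

section \<open>Values of bistars\<close>

text \<open>The reflection of a bistar. As \<open>2 - k\<close> is truncated, it is injective only
  on sets with core indices 0, 1, 2.\<close>

fun swap :: "vertex \<Rightarrow> vertex" where
  "swap (Core k) = Core (2 - k)"
| "swap (Leg x j) = Leg (Label (\<not> side x) (pos x)) j"

lemma option_of_iso:
  assumes "sym E" "sym E'" "finite W" "inj_on \<phi> W" "option_of E W Y"
    and edge: "\<And>u v. u \<in> W \<Longrightarrow> v \<in> W \<Longrightarrow> (\<phi> u, \<phi> v) \<in> E' \<longleftrightarrow> (u, v) \<in> E"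
  shows "option_of E' (\<phi> ` W) (\<phi> ` Y)" and "gval E' (\<phi> ` Y) = gval E Y"
proof -
  show "option_of E' (\<phi> ` W) (\<phi> ` Y)"
    using assms(5,4) by (rule option_of_image) (simp add: edge)
  have Y: "Y \<subseteq> W" "Y = {} \<or> conn E Y"
    using assms(5) by (auto simp: option_of_def)
  show "gval E' (\<phi> ` Y) = gval E Y"
  proof (cases "Y = {}")
    case False
    show ?thesis
    proof (rule gval_iso[OF assms(1,2)])
      show "finite Y" "conn E Y" "inj_on \<phi> Y"
        using Y False assms(3,4) by (auto intro: finite_subset inj_on_subset)
    qed (use Y(1) edge in blast)
  qed simp
qed

lemma inj_swap: "inj_on swap (leg_verts {0, 1, 2} f)"
proof (rule inj_onI)
  fix u v assume "u \<in> leg_verts {0, 1, 2} f" "v \<in> leg_verts {0, 1, 2} f" "swap u = swap v"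
  then show "u = v"
    by (cases u; cases v) (auto simp: label_eq_iff)
qed

lemma adj_swap:
  assumes "u \<in> leg_verts {0, 1, 2} f" "v \<in> leg_verts {0, 1, 2} f"
  shows "adj (swap u) (swap v) \<longleftrightarrow> adj u v"
proof -
  have ctr: "2 - k = ctr (\<not> s) \<longleftrightarrow> k = ctr s" if "k \<in> {0, 1, 2}" for k s
    using that by (auto simp: ctr_def)
  show ?thesis
  proof (cases u; cases v)
    fix k m assume "u = Core k" "v = Core m"
    moreover have "k \<in> {0, 1, 2}" "m \<in> {0, 1, 2}"
      using calculation assms by simp_all
    ultimately show ?thesis
      by (elim insertE; simp)
  next
    fix k x j assume "u = Core k" "v = Leg x j"
    with assms ctr[of k "side x"] show ?thesis
      by simp
  next
    fix x j k assume "u = Leg x j" "v = Core k"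
    with assms ctr[of k "side x"] show ?thesis
      by simp
  next
    fix x i y j assume "u = Leg x i" "v = Leg y j"
    then show ?thesis
      by (simp add: label_eq_iff[of x y])
  qed
qed

lemma swap_leg_verts: "swap ` leg_verts {0, 1, 2} (join g h) = leg_verts {0, 1, 2} (join h g)"
proof (rule vertex_set_eqI)
  fix k
  have "Core k \<in> swap ` leg_verts {0, 1, 2} (join g h) \<longleftrightarrow> (\<exists>m\<in>{0, 1, 2}. k = 2 - m)"
  proof
    assume "Core k \<in> swap ` leg_verts {0, 1, 2} (join g h)"
    then obtain v where v: "v \<in> leg_verts {0, 1, 2} (join g h)" "Core k = swap v"
      by blast
    then show "\<exists>m\<in>{0, 1, 2}. k = 2 - m"
      by (cases v) auto
  next
    assume "\<exists>m\<in>{0, 1, 2}. k = 2 - m"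
    then obtain m where "m \<in> {0, 1, 2}" "k = 2 - m"
      by blast
    then show "Core k \<in> swap ` leg_verts {0, 1, 2} (join g h)"
      by (intro image_eqI[of _ _ "Core m"]) auto
  qed
  also have "\<dots> \<longleftrightarrow> k \<in> {0, 1, 2}"
    by auto
  finally show "Core k \<in> swap ` leg_verts {0, 1, 2} (join g h) \<longleftrightarrow> Core k \<in> leg_verts {0, 1, 2} (join h g)"
    by simp
next
  fix x j
  show "Leg x j \<in> swap ` leg_verts {0, 1, 2} (join g h) \<longleftrightarrow> Leg x j \<in> leg_verts {0, 1, 2} (join h g)"
  proof
    assume "Leg x j \<in> swap ` leg_verts {0, 1, 2} (join g h)"
    then obtain v where v: "v \<in> leg_verts {0, 1, 2} (join g h)" "Leg x j = swap v"
      by blast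
    then show "Leg x j \<in> leg_verts {0, 1, 2} (join h g)"
      by (cases v) (auto simp: join_def)
  next
    assume "Leg x j \<in> leg_verts {0, 1, 2} (join h g)"
    then show "Leg x j \<in> swap ` leg_verts {0, 1, 2} (join g h)"
      by (intro image_eqI[of _ _ "Leg (Label (\<not> side x) (pos x)) j"]) (auto simp: join_def)
  qed
qed

section \<open>Moves in a bistar\<close>

locale two_leg_functions =
  fixes g h :: "nat \<times> nat \<Rightarrow> nat"
  assumes fin_g: "finite {p. 0 < g p}" and fin_h: "finite {p. 0 < h p}"
begin

abbreviation W :: "vertex set" where
  "W \<equiv> leg_verts {0, 1, 2} (join g h)"

lemma attached_W: "attached {0, 1, 2} (join g h)"
  using fin_g fin_h by (rule attached_join) auto

lemma finite_W: "finite W"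
  using attached_W by (simp add: finite_leg_verts)

lemma conn_W: "conn leg_rel W"
  using attached_W by (simp add: conn_leg_verts)

lemma option_of_swap:
  assumes "option_of leg_rel W Y"
  shows "option_of leg_rel (leg_verts {0, 1, 2} (join h g)) (swap ` Y)" "gval leg_rel (swap ` Y) = gval leg_rel Y"
proof -
  have edge: "(swap u, swap v) \<in> leg_rel \<longleftrightarrow> (u, v) \<in> leg_rel" if "u \<in> W" "v \<in> W" for u v
    unfolding leg_rel_iff using that by (rule adj_swap)
  note iso = option_of_iso[OF sym_leg_rel sym_leg_rel finite_W inj_swap assms edge]
  show "option_of leg_rel (leg_verts {0, 1, 2} (join h g)) (swap ` Y)"
    using iso(1) unfolding swap_leg_verts .
  show "gval leg_rel (swap ` Y) = gval leg_rel Y"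
    by (rule iso(2))
qed

text \<open>At most two of the three core vertices can be deleted, so
  \<open>conn_subset_leg_verts\<close> applies.\<close>

lemma option_W_leg_verts:
  assumes "option_of leg_rel W Y"
  obtains K' f' where "Y = leg_verts K' f'" "K' \<subseteq> {0, 1, 2}" "\<forall>x. f' x \<le> join g h x" "attached K' f'"
    "conn leg_rel Y" "K' \<noteq> {}"
proof -
  have sub: "Y \<subseteq> W" and X: "finite (W - Y)" "card (W - Y) \<le> 2"
    using assms by (auto simp: option_of_def card_insert_if)
  have "\<exists>k. Core k \<in> Y"
  proof (rule ccontr)
    assume "\<nexists>k. Core k \<in> Y"
    then have "{Core 0, Core 1, Core 2} \<subseteq> W - Y"
      by auto
    from card_mono[OF X(1) this] X(2) show False
      by simp
  qed
  then obtain k where k: "Core k \<in> Y" ..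
  then have conn: "conn leg_rel Y"
    using assms by (auto simp: option_of_def)
  obtain K' f' where "Y = leg_verts K' f'" "K' \<subseteq> {0, 1, 2}" "\<forall>x. f' x \<le> join g h x" "attached K' f'"
    using conn_subset_leg_verts[OF attached_W sub conn k] .
  with conn k show ?thesis
    by (intro that[of K' f']) auto
qed

text \<open>No left leg can survive its center, so the center and at most one further vertex must
  clear the left side. Either the left star is P_1, deleted alone or with the middle vertex, or it
  is S_1, deleted entirely.\<close>

lemma option_W_no_left:
  assumes opt: "option_of leg_rel W Y" and left: "Core 0 \<notin> Y"
  shows "(g = zero_legs \<or> (\<exists>p. g = zero_legs(p := 1))) \<and> Y = leg_verts {1, 2} (join zero_legs h) \<or>
         g = zero_legs \<and> Y = leg_verts {2} (join zero_legs h)"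
proof -
  obtain K f where Y: "Y = leg_verts K f" "K \<subseteq> {0, 1, 2}" "\<forall>x. f x \<le> join g h x" "attached K f" "K \<noteq> {}"
    using opt by (rule option_W_leg_verts)
  have K: "0 \<notin> K" "K \<subseteq> {1, 2}"
    using left Y by auto
  have f0: "f (Label False p) = 0" for p
    using Y(4) K(1) by (fastforce simp: attached_def ctr_def)
  have f: "f = join zero_legs (\<lambda>p. f (Label True p))"
  proof
    fix x
    show "f x = join zero_legs (\<lambda>p. f (Label True p)) x"
    proof (cases x)
      case (Label s p)
      then show ?thesis
        using f0 by (cases s) (simp_all add: join_def)
    qed
  qed
  have X0: "Core 0 \<in> W - Y"
    using left by simp
  have legs: "Leg (Label False p) j \<in> W - Y" if "1 \<le> j" "j \<le> g p" for p j
    using that by (simp add: Y(1) f0 join_def)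
  have right: "f (Label True p) = h p" if "\<And>j. Leg (Label True p) j \<notin> W - Y" for p
    using that[of "h p"] Y(3)[rule_format, of "Label True p"] by (force simp: Y(1) join_def)
  consider (a) "W - Y = {Core 0}" | (b) v where "W - Y = {Core 0, v}" "adj (Core 0) v"
  proof -
    consider v where "W - Y = {v}" | u v where "W - Y = {u, v}" "adj u v"
      using opt by (auto simp: option_of_def)
    then show thesis
    proof cases
      case (1 v)
      have "v = Core 0"
        using X0 unfolding 1 by simp
      with 1 show thesis
        by (intro a) simp
    next
      case (2 u v)
      have "adj v u"
        using 2(2) sym_leg_rel by (auto simp: sym_def)
      with 2 X0 b[of v] b[of u] show thesis
        by (auto simp: insert_commute)
    qed
  qed
  then show ?thesis
  proof cases
    case a
    then have "f (Label True p) = h p" for p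
      by (intro right) simp
    moreover have "g p = 0" for p
      using legs[of 1 p] unfolding a by (cases "g p") auto
    moreover have "K = {1, 2}"
    proof -
      have "Core 1 \<notin> W - Y" "Core 2 \<notin> W - Y"
        unfolding a by simp_all
      then show ?thesis
        using K by (auto simp: Y(1))
    qed
    ultimately show ?thesis
      using f Y(1) by auto
  next
    case (b v)
    show ?thesis
    proof (cases v)
      case (Core k)
      with b(2) have "k = 1"
        by auto
      with b Core have X: "W - Y = {Core 0, Core 1}"
        by simp
      then have "f (Label True p) = h p" for p
        by (intro right) simp
      moreover have "g p = 0" for p
        using legs[of 1 p] unfolding X by (cases "g p") auto
      moreover have "K = {2}"
      proof -
        have "Core 1 \<in> W - Y" "Core 2 \<notin> W - Y"
          unfolding X by simp_all
        then show ?thesis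
          using K by (auto simp: Y(1))
      qed
      ultimately show ?thesis
        using f Y(1) by auto
    next
      case (Leg x j)
      then have x: "\<not> side x" "j = 1"
        using b(2) by (auto simp: ctr_def split: if_splits)
      then obtain p where p: "x = Label False p"
        by (cases x) auto
      have X: "W - Y = {Core 0, Leg (Label False p) 1}"
        using b(1) Leg x p by simp
      then have "f (Label True q) = h q" for q
        by (intro right) simp
      moreover have "g = zero_legs(p := 1)"
      proof
        fix q
        have "g q = 0" if "q \<noteq> p"
          using legs[of 1 q] that unfolding X by (cases "g q") auto
        moreover have "g p = 1"
        proof -
          have "Leg (Label False p) 1 \<in> W"
            using X by blast
          moreover have "\<not> 2 \<le> g p"
            using legs[of 2 p] unfolding X by auto
          ultimately show ?thesis
            by (simp add: join_def)
        qed
        ultimately show "g q = (zero_legs(p := 1)) q"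
          by simp
      qed
      moreover have "K = {1, 2}"
      proof -
        have "Core 1 \<notin> W - Y" "Core 2 \<notin> W - Y"
        unfolding X by simp_all
        then show ?thesis
          using K by (auto simp: Y(1))
      qed
      ultimately have "g = zero_legs(p := 1)" "Y = leg_verts {1, 2} (join zero_legs h)"
        using f Y(1) by simp_all
      then show ?thesis
        by blast
    qed
  qed
qed

text \<open>The middle vertex is the only link between the halves, so it survives together with both
  centers.\<close>

lemma option_W_both:
  assumes opt: "option_of leg_rel W Y" and "Core 0 \<in> Y" "Core 2 \<in> Y"
  shows "(\<exists>g'. shorten g g' \<and> Y = leg_verts {0, 1, 2} (join g' h)) \<or>
         (\<exists>h'. shorten h h' \<and> Y = leg_verts {0, 1, 2} (join g h'))"
proof -
  obtain K f where Y: "Y = leg_verts K f" "K \<subseteq> {0, 1, 2}" "\<forall>x. f x \<le> join g h x" "conn leg_rel Y"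
    using opt by (rule option_W_leg_verts)
  let ?B = "{Core 0} \<union> {Leg x j | x j. \<not> side x}"
  have "Core 0 \<in> Y \<inter> ?B" "Core 2 \<in> Y - ?B"
    using assms by auto
  with Y(4) obtain u v where "u \<in> Y \<inter> ?B" "v \<in> Y - ?B" "(u, v) \<in> leg_rel"
    by (rule conn_cross)
  then have "v = Core 1"
    by (cases v) (auto simp: ctr_def)
  with \<open>v \<in> Y - ?B\<close> assms(2,3) Y have "K = {0, 1, 2}"
    by auto
  with opt Y(1) have "option_of leg_rel W (leg_verts {0, 1, 2} f)"
    by simp
  then show ?thesis
    unfolding Y(1) \<open>K = {0, 1, 2}\<close> by (rule option_of_join[OF _ Y(3)]) blast+
qed

lemma option_W_middle:
  assumes "g = zero_legs \<or> g = zero_legs(p := 1)"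
  shows "option_of leg_rel W (leg_verts {1, 2} (join zero_legs h))"
proof -
  let ?Y = "leg_verts {1, 2} (join zero_legs h)"
  have "?Y \<subseteq> W"
  proof
    fix v assume "v \<in> ?Y"
    then show "v \<in> W"
      by (cases v) (auto simp: join_def split: if_splits)
  qed
  moreover have "conn leg_rel ?Y"
    by (intro conn_leg_verts attached_join) (auto simp: fin_h)
  moreover have "W - ?Y = {Core 0} \<or> W - ?Y = {Core 0, Leg (Label False p) 1}"
    using assms
  proof
    assume "g = zero_legs"
    then have "W - ?Y = {Core 0}"
      by (intro vertex_set_eqI) (auto simp: join_def)
    then show ?thesis ..
  next
    assume "g = zero_legs(p := 1)"
    then have "W - ?Y = {Core 0, Leg (Label False p) 1}"
      by (intro vertex_set_eqI) (auto simp: join_def label_eq_iff split: if_splits)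
    then show ?thesis ..
  qed
  moreover have "(Core 0, Leg (Label False p) 1) \<in> leg_rel"
    by (simp add: ctr_def)
  ultimately show ?thesis
    unfolding option_of_def by blast
qed

lemma option_W_right:
  assumes "g = zero_legs"
  shows "option_of leg_rel W (leg_verts {2} (join zero_legs h))"
proof -
  let ?Y = "leg_verts {2} (join zero_legs h)"
  have "?Y \<subseteq> W"
  proof
    fix v assume "v \<in> ?Y"
    then show "v \<in> W"
      by (cases v) (auto simp: join_def split: if_splits)
  qed
  moreover have "conn leg_rel ?Y"
    by (intro conn_leg_verts attached_star) (auto simp: fin_h)
  moreover have "W - ?Y = {Core 0, Core 1}"
    using assms by (intro vertex_set_eqI) auto
  moreover have "(Core 0, Core 1) \<in> leg_rel"
    by simp
  ultimately show ?thesis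
    unfolding option_of_def by blast
qed

lemma option_W_left_shorten:
  "shorten g g' \<Longrightarrow> option_of leg_rel W (leg_verts {0, 1, 2} (join g' h))"
  using attached_W by (intro option_of_joinI(1)) auto

end

text \<open>Collects the contribution of the left half, to be used for \<open>(g, h)\<close> and,
  after reflection, for \<open>(h, g)\<close>. The induction hypothesis is a premise bounded by the
  number of vertices, which reflection preserves.\<close>

lemma gval_left_moves:
  assumes tlf: "two_leg_functions g h"
    and IH: "\<forall>g' h'. card (leg_verts {0, 1, 2} (join g' h')) < card (leg_verts {0, 1, 2} (join g h)) \<longrightarrow>
      two_leg_functions g' h' \<longrightarrow> gval leg_rel (leg_verts {0, 1, 2} (join g' h')) = class_table ! leg_class g' ! leg_class h'"
  defines "left_value v \<equiv> \<exists>Y. option_of leg_rel (leg_verts {0, 1, 2} (join g h)) Y \<and> gval leg_rel Y = v"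
  shows "g \<noteq> zero_legs \<Longrightarrow> \<exists>m. (leg_class g, m) \<in> set reached \<and> (\<forall>k\<in>set m. left_value (class_table ! k ! leg_class h))"
    and "g = zero_legs \<Longrightarrow> left_value (class_table ! 1 ! leg_class h)"
    and "g = zero_legs \<Longrightarrow> left_value (class_value ! leg_class h)"
    and "option_of leg_rel (leg_verts {0, 1, 2} (join g h)) Y \<Longrightarrow> Core 0 \<notin> Y \<Longrightarrow> gval leg_rel Y \<noteq> class_table ! leg_class g ! leg_class h"
proof -
  interpret two_leg_functions g h
    by (rule tlf)
  have mid: "gval leg_rel (leg_verts {1, 2} (join zero_legs h)) = class_table ! 1 ! leg_class h"
    by (rule gval_star_middle[OF fin_h])
  have star: "gval leg_rel (leg_verts {2} (join zero_legs h)) = class_value ! leg_class h"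
    by (rule gval_star[OF fin_h])
  have short: "left_value (class_table ! leg_class g' ! leg_class h)" if "shorten g g'" for g'
  proof -
    note opt = option_W_left_shorten[OF that]
    have "two_leg_functions g' h"
      using finite_shorten[OF fin_g that] fin_h by unfold_locales
    with opt IH[rule_format, OF option_of_card[OF opt finite_W]] show ?thesis
      unfolding left_value_def by blast
  qed
  have cl_single: "leg_class (zero_legs(p := 1)) = 6" for p
    using cnt_upd[of zero_legs 1 p 1] cnt_upd[of zero_legs 2 p 1]
    by (simp add: leg_class_def count_mod3_def cls_def)
  show "left_value (class_table ! 1 ! leg_class h)" if "g = zero_legs"
    unfolding left_value_def using option_W_middle that mid by blast
  show "left_value (class_value ! leg_class h)" if "g = zero_legs"
    unfolding left_value_def using option_W_right that star by blast
  show "\<exists>m. (leg_class g, m) \<in> set reached \<and> (\<forall>k\<in>set m. left_value (class_table ! k ! leg_class h))" if nz: "g \<noteq> zero_legs"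
  proof (cases "\<exists>p. g = zero_legs(p := 1)")
    \<comment> \<open>S_1 is outside the scope of \<open>shorten_reached\<close>. Deleting it
      entirely gives row 1 and shortening it to P_1 gives row 3, as the entry
      \<open>(6, [1, 3])\<close> demands.\<close>
    case True
    then obtain p where p: "g = zero_legs(p := 1)" ..
    have "shorten g (g(p := g p - 1))"
      by (rule shortenI) (simp_all add: p)
    moreover have "g(p := g p - 1) = zero_legs"
      by (auto simp: p)
    ultimately have "left_value (class_table ! 3 ! leg_class h)"
      using short[of zero_legs] by simp
    moreover have "left_value (class_table ! 1 ! leg_class h)"
      unfolding left_value_def using option_W_middle[of p] p mid by blast
    moreover have "(leg_class g, [1, 3]) \<in> set reached"
      unfolding p cl_single by (simp add: reached_def)
    ultimately show ?thesis
      by (intro exI[of _ "[1, 3]"]) simp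
  next
    case False
    then obtain m where m: "(leg_class g, m) \<in> set reached" "\<forall>k\<in>set m. \<exists>g'. shorten g g' \<and> leg_class g' = k"
      using shorten_reached[OF fin_g nz] by blast
    have "left_value (class_table ! k ! leg_class h)" if "k \<in> set m" for k
    proof -
      from m(2) that obtain g' where g': "shorten g g'" "leg_class g' = k"
        by blast
      from short[OF g'(1)] show ?thesis
        unfolding g'(2) .
    qed
    with m(1) show ?thesis
      by blast
  qed
  show "gval leg_rel Y \<noteq> class_table ! leg_class g ! leg_class h" if opt: "option_of leg_rel W Y" and left: "Core 0 \<notin> Y"
  proof -
    \<comment> \<open>The left star has class 3 or 6. The remainder has the value of row 1 or that
      of the bare right star, and both differ from the row in question.\<close>
    consider "g = zero_legs" "Y = leg_verts {1, 2} (join zero_legs h)"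
      | p where "g = zero_legs(p := 1)" "Y = leg_verts {1, 2} (join zero_legs h)"
      | "g = zero_legs" "Y = leg_verts {2} (join zero_legs h)"
      using option_W_no_left[OF opt left] by blast
    then show ?thesis
    proof cases
      case 1
      have "(1, 3) \<in> set neighbours"
        by (simp add: neighbours_def)
      from neighbours_differ(2)[OF this cl_less_10] show ?thesis
        unfolding 1 mid cl_zero .
    next
      case 2
      have "(1, 6) \<in> set neighbours"
        by (simp add: neighbours_def)
      from neighbours_differ(2)[OF this cl_less_10] show ?thesis
        unfolding 2 mid cl_single .
    next
      case 3
      from gv_neq_tab_center[OF cl_less_10] show ?thesis
        unfolding 3 star cl_zero .
    qed
  qed
qed

text \<open>An option lacks the left center, lacks the right center, or is a shortening; none of
  these has the value of the position. For the smaller values, P_1 is separated because every other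
  side has an entry of \<open>reached\<close> whose classes are all realised.\<close>

lemma gval_bistar:
  assumes "two_leg_functions g h"
  shows "gval leg_rel (leg_verts {0, 1, 2} (join g h)) = class_table ! leg_class g ! leg_class h"
  using assms
proof (induction "card (leg_verts {0, 1, 2} (join g h))" arbitrary: g h rule: less_induct)
  case less
  let ?W = "leg_verts {0, 1, 2} (join g h)" and ?W' = "leg_verts {0, 1, 2} (join h g)"
  interpret L: two_leg_functions g h
    by (rule less.prems)
  interpret R: two_leg_functions h g
    by unfold_locales (rule L.fin_h L.fin_g)+
  have card_eq: "card ?W' = card ?W"
    unfolding swap_leg_verts[of g h, symmetric] by (rule card_image[OF inj_swap])
  have IH: "\<forall>g' h'. card (leg_verts {0, 1, 2} (join g' h')) < card ?W \<longrightarrow>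
      two_leg_functions g' h' \<longrightarrow> gval leg_rel (leg_verts {0, 1, 2} (join g' h')) = class_table ! leg_class g' ! leg_class h'"
    using less.hyps by blast
  note from_left = gval_left_moves[OF less.prems IH]
  note from_right = gval_left_moves[OF R.two_leg_functions_axioms IH[folded card_eq]]
  have commute: "class_table ! leg_class h ! leg_class g = class_table ! leg_class g ! leg_class h"
    by (rule tab_commute[OF cl_less_10 cl_less_10])
  have swap: "\<exists>Y. option_of leg_rel ?W Y \<and> gval leg_rel Y = v" if "\<exists>Y. option_of leg_rel ?W' Y \<and> gval leg_rel Y = v" for v
  proof -
    from that obtain Y where "option_of leg_rel ?W' Y" "gval leg_rel Y = v"
      by blast
    with R.option_of_swap[of Y] show ?thesis
      by blast
  qed
  show ?case
  proof (rule gval_eqI[OF sym_leg_rel L.conn_W L.finite_W])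
    fix Y assume opt: "option_of leg_rel ?W Y"
    consider "Core 0 \<notin> Y" | "Core 2 \<notin> Y" | "Core 0 \<in> Y" "Core 2 \<in> Y"
      by blast
    then show "gval leg_rel Y \<noteq> class_table ! leg_class g ! leg_class h"
    proof cases
      case 1
      then show ?thesis
        by (rule from_left(4)[OF opt])
    next
      case 2
      \<comment> \<open>Within the position core indices are at most 2, and only
        \<open>Core 2\<close> is mapped to \<open>Core 0\<close>.\<close>
      have "Core 0 \<notin> swap ` Y"
      proof
        assume "Core 0 \<in> swap ` Y"
        then obtain v where v: "v \<in> Y" "Core 0 = swap v"
          by blast
        moreover have "v \<in> ?W"
          using opt v(1) by (auto simp: option_of_def)
        ultimately have "v = Core 2"
          by (cases v) auto
        with v 2 show False
          by simp
      qed
      from from_right(4)[OF L.option_of_swap(1)[OF opt] this] show ?thesis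
        unfolding L.option_of_swap(2)[OF opt] commute .
    next
      case 3
      from L.option_W_both[OF opt 3]
      consider g' where "shorten g g'" "Y = leg_verts {0, 1, 2} (join g' h)"
        | h' where "shorten h h'" "Y = leg_verts {0, 1, 2} (join g h')"
        by blast
      then show ?thesis
      proof cases
        case (1 g')
        have "two_leg_functions g' h"
          using finite_shorten[OF L.fin_g 1(1)] L.fin_h by unfold_locales
        with option_of_card[OF opt L.finite_W] have "gval leg_rel Y = class_table ! leg_class g' ! leg_class h"
          unfolding 1(2) by (rule less.hyps)
        with neighbours_differ(2)[OF shorten_neighbours[OF L.fin_g 1(1)] cl_less_10, of h] show ?thesis
          by simp
      next
        case (2 h')
        have "two_leg_functions g h'"
          using finite_shorten[OF L.fin_h 2(1)] L.fin_g by unfold_locales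
        with option_of_card[OF opt L.finite_W] have "gval leg_rel Y = class_table ! leg_class g ! leg_class h'"
          unfolding 2(2) by (rule less.hyps)
        also have "\<dots> = class_table ! leg_class h' ! leg_class g"
          by (rule tab_commute[OF cl_less_10 cl_less_10])
        finally show ?thesis
          using neighbours_differ(2)[OF shorten_neighbours[OF L.fin_h 2(1)] cl_less_10, of g] commute by simp
      qed
    qed
  next
    fix v assume v: "v < class_table ! leg_class g ! leg_class h"
    consider (both) "g \<noteq> zero_legs" "h \<noteq> zero_legs" | (left) "g = zero_legs" "h \<noteq> zero_legs"
      | (right) "g \<noteq> zero_legs" "h = zero_legs" | (none) "g = zero_legs" "h = zero_legs"
      by blast
    then show "\<exists>Y. option_of leg_rel ?W Y \<and> gval leg_rel Y = v"
    proof cases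
      case both
      obtain m where m: "(leg_class g, m) \<in> set reached"
        "\<forall>k\<in>set m. \<exists>Y. option_of leg_rel ?W Y \<and> gval leg_rel Y = class_table ! k ! leg_class h"
        using from_left(1)[OF both(1)] by blast
      obtain m' where m': "(leg_class h, m') \<in> set reached"
        "\<forall>k\<in>set m'. \<exists>Y. option_of leg_rel ?W' Y \<and> gval leg_rel Y = class_table ! k ! leg_class g"
        using from_right(1)[OF both(2)] by blast
      from reached_bistar[OF m(1) m'(1) v] show ?thesis
      proof
        assume "\<exists>k\<in>set m. class_table ! k ! leg_class h = v"
        with m(2) show ?thesis
          by blast
      next
        assume "\<exists>k\<in>set m'. class_table ! leg_class g ! k = v"
        then obtain k where k: "k \<in> set m'" "class_table ! leg_class g ! k = v" ..
        have "k < 10"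
          using m'(1) k(1) by (auto simp: reached_def)
        have "class_table ! k ! leg_class g = v"
          using tab_commute[OF \<open>k < 10\<close> cl_less_10, of g] k(2) by simp
        with m'(2) k(1) show ?thesis
          by (intro swap) blast
      qed
    next
      case left
      obtain m where m: "(leg_class h, m) \<in> set reached"
        "\<forall>k\<in>set m. \<exists>Y. option_of leg_rel ?W' Y \<and> gval leg_rel Y = class_table ! k ! leg_class g"
        using from_right(1)[OF left(2)] by blast
      have "leg_class g = 3"
        unfolding left(1) by (rule cl_zero)
      from reached_bistar_center[OF m(1) v[unfolded this]] show ?thesis
      proof (elim disjE bexE)
        assume "v = class_table ! 1 ! leg_class h"
        then show ?thesis
          using from_left(2)[OF left(1)] by simp
      next
        assume "v = class_value ! leg_class h"
        then show ?thesis
          using from_left(3)[OF left(1)] by simp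
      next
        fix k assume k: "k \<in> set m" "class_table ! 3 ! k = v"
        have "k < 10"
          using m(1) k(1) by (auto simp: reached_def)
        have "class_table ! k ! leg_class g = v"
          using tab_commute[OF \<open>k < 10\<close> cl_less_10, of g] k(2) \<open>leg_class g = 3\<close> by simp
        with m(2) k(1) show ?thesis
          by (intro swap) blast
      qed
    next
      case right
      obtain m where m: "(leg_class g, m) \<in> set reached"
        "\<forall>k\<in>set m. \<exists>Y. option_of leg_rel ?W Y \<and> gval leg_rel Y = class_table ! k ! leg_class h"
        using from_left(1)[OF right(1)] by blast
      have "leg_class h = 3"
        unfolding right(2) by (rule cl_zero)
      from reached_bistar_center[OF m(1) v[folded commute, unfolded this]] show ?thesis
      proof (elim disjE bexE)
        assume "v = class_table ! 1 ! leg_class g"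
        then show ?thesis
          using from_right(2)[OF right(2)] by (intro swap) simp
      next
        assume "v = class_value ! leg_class g"
        then show ?thesis
          using from_right(3)[OF right(2)] by (intro swap) simp
      next
        fix k assume k: "k \<in> set m" "class_table ! 3 ! k = v"
        have "k < 10"
          using m(1) k(1) by (auto simp: reached_def)
        have "class_table ! k ! leg_class h = v"
          using tab_commute[OF \<open>k < 10\<close> cl_less_10, of h] k(2) \<open>leg_class h = 3\<close> by simp
        with m(2) k(1) show ?thesis
          by blast
      qed
    next
      case none
      with v have False
        by (simp add: class_table_def)
      then show ?thesis ..
    qed
  qed
qed

section \<open>Stars and bistars as induced graphs\<close>

text \<open>The position \<open>(l, i)\<close> corresponds to \<open>On_Path l i\<close>, so its
  first component is also the length.\<close>

definition legs :: "nat multiset \<Rightarrow> nat \<times> nat \<Rightarrow> nat" where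
  "legs M p = (if snd p < count M (fst p) then fst p else 0)"

lemma finite_legs: "finite {p. 0 < legs M p}"
proof (rule finite_subset)
  show "{p. 0 < legs M p} \<subseteq> (SIGMA l:set_mset M. {..<count M l})"
    by (auto simp: legs_def split: if_splits intro: count_inI)
qed auto

lemma two_leg_functions_legs: "two_leg_functions (legs M) (legs N)"
  by unfold_locales (rule finite_legs)+

text \<open>\<open>Empty\<close> shares the class of S_2: on one side of a bistar they add a path of
  1 and of 4 vertices to the other star, and the residues agree.\<close>

fun star_class :: "star \<Rightarrow> nat" where
  "star_class Empty = 1"
| "star_class (Star M) = leg_class (legs M)"

lemma star_class_less_10: "star_class S < 10"
  by (cases S) (simp_all add: cl_less_10)

definition star_rel :: "star \<Rightarrow> star_vertex rel" where
  "star_rel S = star_edges S \<union> (star_edges S)\<inverse>"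

lemma star_rel_Empty [simp]: "star_rel Empty = {}"
  by (simp add: star_rel_def)

lemma star_rel_iff [simp]:
  "(Center, Center) \<notin> star_rel (Star M)"
  "(Center, On_Path l i j) \<in> star_rel (Star M) \<longleftrightarrow> j = 1 \<and> i < count M l \<and> 1 \<le> l"
  "(On_Path l i j, Center) \<in> star_rel (Star M) \<longleftrightarrow> j = 1 \<and> i < count M l \<and> 1 \<le> l"
  "(On_Path l i j, On_Path l' i' j') \<in> star_rel (Star M) \<longleftrightarrow> l = l' \<and> i = i' \<and> i < count M l \<and>
     (1 \<le> j \<and> j' = j + 1 \<and> j' \<le> l \<or> 1 \<le> j' \<and> j = j' + 1 \<and> j \<le> l)"
  by (auto simp: star_rel_def)

lemma star_graph_ind: "star_graph S = ind (star_rel S) (star_verts S)"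
proof -
  have "star_rel S \<subseteq> star_verts S \<times> star_verts S"
    by (auto simp: star_rel_def dest: star_edges_wf)
  then show ?thesis
    by (simp add: star_graph_def ind_def star_rel_def[symmetric] Int_absorb2)
qed

definition bistar_rel :: "star \<Rightarrow> star \<Rightarrow> bistar_vertex rel" where
  "bistar_rel S T = bistar_edges S T \<union> (bistar_edges S T)\<inverse>"

lemma bistar_rel_iff [simp]:
  "(Middle, Middle) \<notin> bistar_rel S T"
  "(Middle, In_Left a) \<in> bistar_rel S T \<longleftrightarrow> S \<noteq> Empty \<and> a = Center"
  "(In_Left a, Middle) \<in> bistar_rel S T \<longleftrightarrow> S \<noteq> Empty \<and> a = Center"
  "(Middle, In_Right a) \<in> bistar_rel S T \<longleftrightarrow> T \<noteq> Empty \<and> a = Center"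
  "(In_Right a, Middle) \<in> bistar_rel S T \<longleftrightarrow> T \<noteq> Empty \<and> a = Center"
  "(In_Left a, In_Left b) \<in> bistar_rel S T \<longleftrightarrow> (a, b) \<in> star_rel S"
  "(In_Right a, In_Right b) \<in> bistar_rel S T \<longleftrightarrow> (a, b) \<in> star_rel T"
  "(In_Left a, In_Right b) \<notin> bistar_rel S T"
  "(In_Right a, In_Left b) \<notin> bistar_rel S T"
  by (auto simp: bistar_rel_def bistar_edges_def star_rel_def)

lemma bistar_ind:
  "bistar S T = ind (bistar_rel S T) (insert Middle (In_Left ` star_verts S \<union> In_Right ` star_verts T))"
proof -
  have "pair_wf_digraph (bistar S T)"
    using pair_graph_bistar[of S T] by (simp add: pair_graph_def pair_digraph_def pair_fin_digraph_def)
  then have "parcs (bistar S T) \<subseteq> pverts (bistar S T) \<times> pverts (bistar S T)"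
    by (auto simp: pair_wf_digraph_def)
  then show ?thesis
    by (simp add: bistar_def ind_def bistar_rel_def[symmetric] Int_absorb2)
qed

lemma sym_star_rel: "sym (star_rel S)"
  by (auto simp: star_rel_def sym_def)

lemma sym_bistar_rel: "sym (bistar_rel S T)"
  by (auto simp: bistar_rel_def sym_def)

definition on_path :: "label \<Rightarrow> nat \<Rightarrow> star_vertex" where
  "on_path x j = On_Path (fst (pos x)) (snd (pos x)) j"

lemma leg_verts_star_cases:
  assumes "v \<in> leg_verts {2} (join zero_legs (legs M))"
  obtains "v = Core 2" | l i j where "v = Leg (Label True (l, i)) j" "i < count M l" "1 \<le> j" "j \<le> l"
proof (cases v)
  case (Core k)
  with assms that(1) show ?thesis
    by simp
next
  case (Leg x j)
  show ?thesis
  proof (cases x)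
    case (Label s p)
    with Leg assms show ?thesis
      using that(2)[of "fst p" "snd p" j] by (cases s) (auto simp: join_def legs_def split: if_splits)
  qed
qed

lemma grundy_star_graph: "\<G> S = class_value ! star_class S"
proof (cases S)
  case Empty
  then have "\<G> S = gval {} ({} :: star_vertex set)"
    by (simp add: gval_def star_graph_ind)
  with Empty show ?thesis
    by (simp add: class_value_def)
next
  case (Star M)
  let ?W = "leg_verts {2} (join zero_legs (legs M))"
  define \<phi> where "\<phi> v = (case v of Core k \<Rightarrow> Center | Leg x j \<Rightarrow> on_path x j)" for v
  note att = attached_star[OF finite_legs[of M]]
  have "gval (star_rel S) (\<phi> ` ?W) = gval leg_rel ?W"
  proof (rule gval_iso[OF sym_leg_rel sym_star_rel])
    show "finite ?W" "conn leg_rel ?W"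
      using att by (simp_all add: finite_leg_verts conn_leg_verts)
    show "inj_on \<phi> ?W"
    proof (rule inj_onI)
      fix u v assume "u \<in> ?W" "v \<in> ?W" "\<phi> u = \<phi> v"
      then show "u = v"
        by (elim leg_verts_star_cases) (auto simp: \<phi>_def on_path_def)
    qed
    fix u v assume "u \<in> ?W" "v \<in> ?W"
    then show "(\<phi> u, \<phi> v) \<in> star_rel S \<longleftrightarrow> (u, v) \<in> leg_rel"
      by (elim leg_verts_star_cases) (auto simp: \<phi>_def on_path_def Star ctr_def)
  qed
  moreover have "\<phi> ` ?W = star_verts S"
  proof
    show "\<phi> ` ?W \<subseteq> star_verts S"
    proof
      fix a assume "a \<in> \<phi> ` ?W"
      then obtain v where "v \<in> ?W" "a = \<phi> v"
        by blast
      then show "a \<in> star_verts S"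
        by (elim leg_verts_star_cases) (auto simp: \<phi>_def on_path_def Star)
    qed
    show "star_verts S \<subseteq> \<phi> ` ?W"
    proof
      fix a assume "a \<in> star_verts S"
      then consider "a = Center" | l i j where "a = On_Path l i j" "i < count M l" "1 \<le> j" "j \<le> l"
        by (auto simp: Star)
      then show "a \<in> \<phi> ` ?W"
      proof cases
        case 1
        then show ?thesis
          by (intro image_eqI[of _ _ "Core 2"]) (simp_all add: \<phi>_def)
      next
        case (2 l i j)
        then show ?thesis
          by (intro image_eqI[of _ _ "Leg (Label True (l, i)) j"])
             (simp_all add: \<phi>_def on_path_def join_def legs_def)
      qed
    qed
  qed
  ultimately show ?thesis
    using gval_star[OF finite_legs[of M]] by (simp add: gval_def star_graph_ind Star)
qed

text \<open>Treats both bistars with exactly one empty side, where \<open>D\<close> is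
  \<open>In_Left\<close> or \<open>In_Right\<close>.\<close>

lemma gval_insert_Middle:
  assumes D: "inj D" "\<And>a. D a \<noteq> Middle"
    and E: "sym E" "(Middle, Middle) \<notin> E" "\<And>a. (Middle, D a) \<in> E \<longleftrightarrow> a = Center"
      "\<And>a. (D a, Middle) \<in> E \<longleftrightarrow> a = Center" "\<And>a b. (D a, D b) \<in> E \<longleftrightarrow> (a, b) \<in> star_rel (Star M)"
  shows "gval E (insert Middle (D ` star_verts (Star M))) = class_table ! 1 ! leg_class (legs M)"
proof -
  let ?W = "leg_verts {1, 2} (join zero_legs (legs M))"
  define \<phi> where "\<phi> v = (case v of Core k \<Rightarrow> if k = 1 then Middle else D Center | Leg x j \<Rightarrow> D (on_path x j))" for v
  have att: "attached {1, 2} (join zero_legs (legs M))"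
    using finite_legs by (intro attached_join) auto
  have cases: thesis if "v \<in> ?W" "v = Core 1 \<Longrightarrow> thesis" "v \<in> leg_verts {2} (join zero_legs (legs M)) \<Longrightarrow> thesis" for v thesis
    using that by (cases v) auto
  have "gval E (\<phi> ` ?W) = gval leg_rel ?W"
  proof (rule gval_iso[OF sym_leg_rel E(1)])
    show "finite ?W" "conn leg_rel ?W"
      using att by (simp_all add: finite_leg_verts conn_leg_verts)
    show "inj_on \<phi> ?W"
    proof (rule inj_onI)
      fix u v assume "u \<in> ?W" "v \<in> ?W" "\<phi> u = \<phi> v"
      then show "u = v"
        using D by (elim cases leg_verts_star_cases) (auto simp: \<phi>_def on_path_def dest: injD, metis+)
    qed
    fix u v assume "u \<in> ?W" "v \<in> ?W"
    then show "(\<phi> u, \<phi> v) \<in> E \<longleftrightarrow> (u, v) \<in> leg_rel"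
      by (elim cases leg_verts_star_cases) (auto simp: \<phi>_def on_path_def E(2-) ctr_def)
  qed
  moreover have "\<phi> ` ?W = insert Middle (D ` star_verts (Star M))"
  proof
    show "\<phi> ` ?W \<subseteq> insert Middle (D ` star_verts (Star M))"
    proof
      fix a assume "a \<in> \<phi> ` ?W"
      then obtain v where "v \<in> ?W" "a = \<phi> v"
        by blast
      then show "a \<in> insert Middle (D ` star_verts (Star M))"
        by (elim cases leg_verts_star_cases) (auto simp: \<phi>_def on_path_def)
    qed
    show "insert Middle (D ` star_verts (Star M)) \<subseteq> \<phi> ` ?W"
    proof
      fix a assume "a \<in> insert Middle (D ` star_verts (Star M))"
      then consider "a = Middle" | "a = D Center"
        | l i j where "a = D (On_Path l i j)" "i < count M l" "1 \<le> j" "j \<le> l"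
        by auto
      then show "a \<in> \<phi> ` ?W"
      proof cases
        case 1
        then show ?thesis
          by (intro image_eqI[of _ _ "Core 1"]) (simp_all add: \<phi>_def)
      next
        case 2
        then show ?thesis
          by (intro image_eqI[of _ _ "Core 2"]) (simp_all add: \<phi>_def)
      next
        case (3 l i j)
        then show ?thesis
          by (intro image_eqI[of _ _ "Leg (Label True (l, i)) j"])
             (simp_all add: \<phi>_def on_path_def join_def legs_def)
      qed
    qed
  qed
  ultimately show ?thesis
    using gval_star_middle[OF finite_legs[of M]] by simp
qed

lemma grundy_bistar_Star:
  "grundy (bistar (Star M) (Star N)) = class_table ! leg_class (legs M) ! leg_class (legs N)"
proof -
  let ?W = "leg_verts {0, 1, 2} (join (legs M) (legs N))"
  interpret two_leg_functions "legs M" "legs N"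
    by (rule two_leg_functions_legs)
  define \<phi> where "\<phi> v = (case v of
      Core k \<Rightarrow> if k = 0 then In_Left Center else if k = 1 then Middle else In_Right Center
    | Leg x j \<Rightarrow> if side x then In_Right (on_path x j) else In_Left (on_path x j))" for v
  let ?V = "insert Middle (In_Left ` star_verts (Star M) \<union> In_Right ` star_verts (Star N))"
  have cases: thesis if "v \<in> ?W" "v = Core 0 \<Longrightarrow> thesis" "v = Core 1 \<Longrightarrow> thesis" "v = Core 2 \<Longrightarrow> thesis"
    "\<And>l i j. v = Leg (Label False (l, i)) j \<Longrightarrow> i < count M l \<Longrightarrow> 1 \<le> j \<Longrightarrow> j \<le> l \<Longrightarrow> thesis"
    "\<And>l i j. v = Leg (Label True (l, i)) j \<Longrightarrow> i < count N l \<Longrightarrow> 1 \<le> j \<Longrightarrow> j \<le> l \<Longrightarrow> thesis" for v thesis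
  proof (cases v)
    case (Core k)
    with that(1-4) show ?thesis
      by auto
  next
    case (Leg x j)
    show ?thesis
    proof (cases x)
      case (Label s p)
      with Leg that(1) that(5)[of "fst p" "snd p" j] that(6)[of "fst p" "snd p" j] show ?thesis
        by (cases s) (auto simp: join_def legs_def split: if_splits)
    qed
  qed
  have "gval (bistar_rel (Star M) (Star N)) (\<phi> ` ?W) = gval leg_rel ?W"
  proof (rule gval_iso[OF sym_leg_rel sym_bistar_rel finite_W conn_W])
    show "inj_on \<phi> ?W"
    proof (rule inj_onI)
      fix u v assume "u \<in> ?W" "v \<in> ?W" "\<phi> u = \<phi> v"
      then show "u = v"
        by (elim cases) (auto simp: \<phi>_def on_path_def)
    qed
    fix u v assume "u \<in> ?W" "v \<in> ?W"
    then show "(\<phi> u, \<phi> v) \<in> bistar_rel (Star M) (Star N) \<longleftrightarrow> (u, v) \<in> leg_rel"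
      by (elim cases) (auto simp: \<phi>_def on_path_def ctr_def)
  qed
  moreover have "\<phi> ` ?W = ?V"
  proof
    show "\<phi> ` ?W \<subseteq> ?V"
    proof
      fix a assume "a \<in> \<phi> ` ?W"
      then obtain v where "v \<in> ?W" "a = \<phi> v"
        by blast
      then show "a \<in> ?V"
        by (elim cases) (auto simp: \<phi>_def on_path_def)
    qed
    show "?V \<subseteq> \<phi> ` ?W"
    proof
      fix a assume "a \<in> ?V"
      then consider "a = Middle" | "a = In_Left Center" | "a = In_Right Center"
        | l i j where "a = In_Left (On_Path l i j)" "i < count M l" "1 \<le> j" "j \<le> l"
        | l i j where "a = In_Right (On_Path l i j)" "i < count N l" "1 \<le> j" "j \<le> l"
        by auto
      then show "a \<in> \<phi> ` ?W"
      proof cases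
        case 1
        then show ?thesis
          by (intro image_eqI[of _ _ "Core 1"]) (simp_all add: \<phi>_def)
      next
        case 2
        then show ?thesis
          by (intro image_eqI[of _ _ "Core 0"]) (simp_all add: \<phi>_def)
      next
        case 3
        then show ?thesis
          by (intro image_eqI[of _ _ "Core 2"]) (simp_all add: \<phi>_def)
      next
        case (4 l i j)
        then show ?thesis
          by (intro image_eqI[of _ _ "Leg (Label False (l, i)) j"])
             (simp_all add: \<phi>_def on_path_def join_def legs_def)
      next
        case (5 l i j)
        then show ?thesis
          by (intro image_eqI[of _ _ "Leg (Label True (l, i)) j"])
             (simp_all add: \<phi>_def on_path_def join_def legs_def)
      qed
    qed
  qed
  ultimately show ?thesis
    using gval_bistar[OF two_leg_functions_axioms] by (simp add: gval_def bistar_ind)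
qed

lemma grundy_bistar: "grundy (bistar S T) = class_table ! star_class S ! star_class T"
proof (cases S; cases T)
  fix M N assume "S = Star M" "T = Star N"
  then show ?thesis
    by (simp add: grundy_bistar_Star)
next
  fix N assume ST: "S = Empty" "T = Star N"
  have "gval (bistar_rel S T) (insert Middle (In_Right ` star_verts (Star N))) = class_table ! 1 ! leg_class (legs N)"
    by (rule gval_insert_Middle) (auto simp: ST sym_bistar_rel inj_def)
  with ST show ?thesis
    by (simp add: gval_def bistar_ind)
next
  fix M assume ST: "S = Star M" "T = Empty"
  have "gval (bistar_rel S T) (insert Middle (In_Left ` star_verts (Star M))) = class_table ! 1 ! leg_class (legs M)"
    by (rule gval_insert_Middle) (auto simp: ST sym_bistar_rel inj_def)
  with ST tab_commute[of 1 "leg_class (legs M)"] cl_less_10[of "legs M"] show ?thesis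
    by (simp add: gval_def bistar_ind)
next
  assume ST: "S = Empty" "T = Empty"
  have "gval (bistar_rel S T) ((\<lambda>_. Middle) ` {0 :: int}) = gval line {0}"
  proof (rule gval_iso[OF sym_line sym_bistar_rel])
    show "conn line {0}"
      using conn_line_iff[of 0 0] by simp
  qed (auto simp: line_def)
  then have "gval (bistar_rel S T) {Middle} = 1"
    using gval_line[of 0 0] by simp
  with ST show ?thesis
    by (simp add: gval_def bistar_ind class_table_def)
qed

section \<open>The equivalence classes\<close>

lemma Star_in_R_iff: "Star M \<in> \<R> \<longleftrightarrow> set_mset M \<subseteq> {1, 2}"
  by (auto simp: \<R>_def)

text \<open>For paths of 1 or 2 vertices, residue and length coincide.\<close>

lemma cnt_legs:
  assumes "set_mset M \<subseteq> {1, 2}" "r \<in> {1, 2}"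
  shows "count_mod3 r (legs M) = count M r"
proof -
  have "{p. legs M p mod 3 = r} = Pair r ` {..<count M r}"
  proof (intro equalityI subsetI)
    fix p assume p: "p \<in> {p. legs M p mod 3 = r}"
    then have "snd p < count M (fst p)"
      using assms(2) by (auto simp: legs_def split: if_splits)
    moreover from this have "fst p \<in># M"
      by (intro count_inI) auto
    ultimately have "fst p = r"
      using p assms(1) by (auto simp: legs_def)
    with \<open>snd p < count M (fst p)\<close> show "p \<in> Pair r ` {..<count M r}"
      by (cases p) auto
  qed (use assms(2) in \<open>auto simp: legs_def\<close>)
  then show ?thesis
    unfolding count_mod3_def by (simp add: card_image inj_on_def)
qed

lemma star_class_Star: "set_mset M \<subseteq> {1, 2} \<Longrightarrow> star_class (Star M) = cls (count M 1) (count M 2)"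
  by (simp add: leg_class_def cnt_legs)

lemma mset_12_eq_iff:
  assumes "set_mset M \<subseteq> {1, 2}" "set_mset N \<subseteq> {1, 2}"
  shows "M = N \<longleftrightarrow> count M 1 = count N 1 \<and> count M 2 = count N 2"
proof
  assume eq: "count M 1 = count N 1 \<and> count M 2 = count N 2"
  show "M = N"
  proof (rule multiset_eqI)
    fix x
    show "count M x = count N x"
    proof (cases "x \<in> {1, 2}")
      case False
      with assms have "x \<notin># M" "x \<notin># N"
        by blast+
      then show ?thesis
        by (simp add: not_in_iff)
    qed (use eq in auto)
  qed
qed simp

text \<open>On \<R> each defining condition becomes a condition on the two path counts. The named
  classes take the indices 1, 3, 4, 6, 7, 9; each Grundy value then has exactly one index left, that
  of its plain class.\<close>

lemma in_classes_iff:
  assumes "i < 10"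
  shows "S \<in> classes ! i \<longleftrightarrow> S \<in> \<R> \<and> star_class S = i"
proof -
  have named: "(S \<in> D0_star \<longleftrightarrow> star_class S = 1) \<and> (S \<in> D1_star \<longleftrightarrow> star_class S = 3) \<and>
      (S \<in> D1_box \<longleftrightarrow> star_class S = 4) \<and> (S \<in> D2_star \<longleftrightarrow> star_class S = 6) \<and>
      (S \<in> D2_box \<longleftrightarrow> star_class S = 7) \<and> (S \<in> D3_box \<longleftrightarrow> star_class S = 9)" if "S \<in> \<R>"
  proof (cases S)
    case Empty
    then show ?thesis
      by (simp add: D0_star_def D1_star_def D1_box_def D2_star_def D2_box_def D3_box_def grundy_star_graph class_value_def \<R>_def)
  next
    case (Star M)
    with that have M: "set_mset M \<subseteq> {1, 2}"
      by (simp add: Star_in_R_iff)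
    have eqs: "M = {#} \<longleftrightarrow> count M 1 = 0 \<and> count M 2 = 0"
      "M = {#1#} \<longleftrightarrow> count M 1 = 1 \<and> count M 2 = 0"
      "M = {#2#} \<longleftrightarrow> count M 1 = 0 \<and> count M 2 = 1"
      "M = {#2, 2#} \<longleftrightarrow> count M 1 = 0 \<and> count M 2 = 2"
      "M = {#2, 1#} \<longleftrightarrow> count M 1 = 1 \<and> count M 2 = 1"
      "M = {#2, 2, 2#} \<longleftrightarrow> count M 1 = 0 \<and> count M 2 = 3"
      by (subst mset_12_eq_iff[OF M]; simp add: numeral_eq_Suc)+
    define a b where "a = count M 1" and "b = count M 2"
    show ?thesis
      unfolding D0_star_def D1_star_def D1_box_def D2_star_def D2_box_def D3_box_def insert_iff mem_Collect_eq
        grundy_star_graph Star star_class_Star[OF M] star.inject paths2.simps eqs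
        a_def[symmetric] b_def[symmetric]
      using that[unfolded Star] by (simp add: cls_def class_value_def)
  qed
  have sub: "D0_star \<union> D1_star \<union> D1_box \<union> D2_star \<union> D2_box \<union> D3_box \<subseteq> \<R>"
    by (auto simp: D0_star_def D1_star_def D1_box_def D2_star_def D2_box_def D3_box_def \<R>_def)
  have plain: "S \<in> D_plain k \<longleftrightarrow> S \<in> \<R> \<and> class_value ! star_class S = k \<and> star_class S \<notin> {1, 3, 4, 6, 7, 9}" for k
    unfolding D_plain_def using named by (auto simp: grundy_star_graph)
  have less_10: "n = 0 \<or> n = 1 \<or> n = 2 \<or> n = 3 \<or> n = 4 \<or> n = 5 \<or> n = 6 \<or> n = 7 \<or> n = 8 \<or> n = 9"
    if "n < 10" for n :: nat
    using that by (auto simp: numeral_eq_Suc less_Suc_eq)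
  have all: "i = 0 \<or> i = 1 \<or> i = 2 \<or> i = 3 \<or> i = 4 \<or> i = 5 \<or> i = 6 \<or> i = 7 \<or> i = 8 \<or> i = 9"
    "star_class S = 0 \<or> star_class S = 1 \<or> star_class S = 2 \<or> star_class S = 3 \<or> star_class S = 4 \<or>
     star_class S = 5 \<or> star_class S = 6 \<or> star_class S = 7 \<or> star_class S = 8 \<or> star_class S = 9"
    using less_10[OF assms] less_10[OF star_class_less_10] by simp_all
  have plain_iff: "S \<in> D_plain 0 \<longleftrightarrow> S \<in> \<R> \<and> star_class S = 0" "S \<in> D_plain 1 \<longleftrightarrow> S \<in> \<R> \<and> star_class S = 2"
    "S \<in> D_plain 2 \<longleftrightarrow> S \<in> \<R> \<and> star_class S = 5" "S \<in> D_plain 3 \<longleftrightarrow> S \<in> \<R> \<and> star_class S = 8"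
    unfolding plain using all(2) by (elim disjE; simp add: class_value_def)+
  have named_iff: "S \<in> D0_star \<longleftrightarrow> S \<in> \<R> \<and> star_class S = 1" "S \<in> D1_star \<longleftrightarrow> S \<in> \<R> \<and> star_class S = 3"
    "S \<in> D1_box \<longleftrightarrow> S \<in> \<R> \<and> star_class S = 4" "S \<in> D2_star \<longleftrightarrow> S \<in> \<R> \<and> star_class S = 6"
    "S \<in> D2_box \<longleftrightarrow> S \<in> \<R> \<and> star_class S = 7" "S \<in> D3_box \<longleftrightarrow> S \<in> \<R> \<and> star_class S = 9"
    using named sub by blast+
  show ?thesis
    using all(1) by (elim disjE) (simp_all add: classes_def plain_iff[unfolded One_nat_def] named_iff)
qed

lemma star_class_attained:
  assumes "i < 10"
  obtains S where "S \<in> \<R>" "star_class S = i"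
proof -
  let ?S = "\<lambda>a b. Star (replicate_mset a 1 + replicate_mset b 2)"
  have S: "?S a b \<in> \<R>" "star_class (?S a b) = cls a b" for a b
  proof -
    have M: "set_mset (replicate_mset a 1 + replicate_mset b 2) \<subseteq> {1, 2 :: nat}"
      by (auto simp: set_mset_replicate_mset_subset)
    then show "?S a b \<in> \<R>"
      by (simp only: Star_in_R_iff)
    show "star_class (?S a b) = cls a b"
      by (subst star_class_Star[OF M]) simp
  qed
  \<comment> \<open>Path counts of representatives of the classes 0 to 9, in this order.\<close>
  have "list_all (\<lambda>i. list_ex (\<lambda>(a, b). cls a b = i)
      [(0, 4), (0, 1), (1, 4), (0, 0), (3, 0), (0, 5), (1, 0), (2, 1), (1, 5), (3, 1)]) [0..<10]"
    by code_simp
  from list_all_uptD[OF this assms] obtain a b where "cls a b = i"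
    by (auto simp: list_ex_iff)
  with S[of a b] show ?thesis
    by (intro that[of "?S a b"]) (simp_all only:)
qed

lemma R_subset: "\<R> \<subseteq> stars_or_empty"
  by (force simp: \<R>_def stars_or_empty_def)

lemma tab_rows_differ:
  assumes "i < 10" "j < 10" "i \<noteq> j"
  obtains k where "k < 10" "class_table ! i ! k \<noteq> class_table ! j ! k"
proof -
  have "list_all (\<lambda>i. list_all (\<lambda>j. i = j \<or> list_ex (\<lambda>k. class_table ! i ! k \<noteq> class_table ! j ! k) [0..<10]) [0..<10]) [0..<10]"
    by code_simp
  from list_all_uptD[OF list_all_uptD[OF this assms(1)] assms(2)] assms(3) show ?thesis
    using that by (auto simp: list_ex_iff)
qed

text \<open>Bistar values depend only on classes. Conversely, distinct rows differ in some column,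
  and a star of \<R> in that column is an admissible test.\<close>

lemma sim2_iff: "S \<sim>\<^sub>2 S' \<longleftrightarrow> star_class S = star_class S'"
proof
  assume sim: "S \<sim>\<^sub>2 S'"
  show "star_class S = star_class S'"
  proof (rule ccontr)
    assume "star_class S \<noteq> star_class S'"
    then obtain k where k: "k < 10" "class_table ! star_class S ! k \<noteq> class_table ! star_class S' ! k"
      using tab_rows_differ[OF star_class_less_10 star_class_less_10] by blast
    obtain T where "T \<in> \<R>" "star_class T = k"
      using k(1) by (rule star_class_attained)
    with sim k(2) R_subset show False
      by (auto simp: sim2_def grundy_bistar)
  qed
qed (simp add: sim2_def grundy_bistar)

theorem theorem6:
  shows "\<R> // {(S, S'). S \<in> \<R> \<and> S' \<in> \<R> \<and> S \<sim>\<^sub>2 S'} = set classes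
    \<and> distinct classes
    \<and> (\<forall>i < 10. \<forall>j < 10. \<forall>S \<in> classes ! i. \<forall>S' \<in> classes ! j.
          grundy (bistar S S') = entry_value (grundy_table ! i ! j) (\<G> S) (\<G> S'))"
proof (intro conjI allI impI ballI)
  let ?r = "{(S, S'). S \<in> \<R> \<and> S' \<in> \<R> \<and> S \<sim>\<^sub>2 S'}"
  have len: "length classes = 10"
    by (simp add: classes_def)
  have cls: "classes ! i = {S \<in> \<R>. star_class S = i}" if "i < 10" for i
    using in_classes_iff[OF that] by blast
  have image: "?r `` {S} = classes ! star_class S" if "S \<in> \<R>" for S
    unfolding cls[OF star_class_less_10] using that by (auto simp: sim2_iff)
  show "\<R> // ?r = set classes"
  proof (intro equalityI subsetI)
    fix A assume "A \<in> \<R> // ?r"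
    then obtain S where "S \<in> \<R>" "A = ?r `` {S}"
      by (rule quotientE)
    then show "A \<in> set classes"
      using image star_class_less_10[of S] len by simp
  next
    fix A assume "A \<in> set classes"
    then obtain i where i: "i < 10" "A = classes ! i"
      by (auto simp: in_set_conv_nth len)
    obtain S where "S \<in> \<R>" "star_class S = i"
      using i(1) by (rule star_class_attained)
    then show "A \<in> \<R> // ?r"
      using quotientI[of S \<R> ?r] image[of S] i(2) by simp
  qed
  show "distinct classes"
    unfolding distinct_conv_nth
  proof (intro allI impI)
    fix i j assume ij: "i < length classes" "j < length classes" "i \<noteq> j"
    then obtain S where "S \<in> \<R>" "star_class S = i"
      using star_class_attained len by metis
    with ij show "classes ! i \<noteq> classes ! j"
      unfolding len by (auto simp: cls)
  qed
  fix i j S S' assume "i < 10" "j < 10" "S \<in> classes ! i" "S' \<in> classes ! j"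
  then show "grundy (bistar S S') = entry_value (grundy_table ! i ! j) (\<G> S) (\<G> S')"
    by (simp add: cls grundy_bistar grundy_star_graph tab_entry_value)
qed

end
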